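(* Let $\{(\boldsymbol q_h^{n+1},\boldsymbol\eta_h^{n+1},\boldsymbol u_h^{n+1},p_h^{n+1},\boldsymbol\lambda_h^{n+1})\}_{n=0}^{N-1}\subset \boldsymbol V_h^s\times\boldsymbol V_h^s\times\boldsymbol V_h^f\times M_h^f\times\boldsymbol V_h^g$ be given by the fully discrete Robin-based loosely coupled scheme described in the context, with initial values $\boldsymbol q_h^0,\boldsymbol\eta_h^0\in\boldsymbol V_h^s$, $\boldsymbol u_h^0\in\boldsymbol V_h^f$, $\boldsymbol\lambda_h^0\in\boldsymbol V_h^g$. Define $$\mathcal S_h^{n}=\|\boldsymbol\eta_h^{n}\|_{S}^2+\rho_s\|\boldsymbol q_h^{n}\|_{L^2(\Omega_s)}^2+\rho_f\|\boldsymbol u_h^{n}\|_{L^2(\Omega_f)}^2+\Delta t\Big(\alpha\|\boldsymbol u_h^n\|_{L^2(\Sigma)}^2+\frac1\alpha\|\boldsymbol\lambda_h^{n}\|_{L^2(\Sigma)}^2\Big),$$ $$\mathcal Z_h^n=\rho_f\|\boldsymbol u_h^{n}-\boldsymbol u_h^{n-1}\|_{L^2(\Omega_f)}^2+\alpha\Delta t\,\|\partial_{\Delta t}\boldsymbol\eta_h^{n}-\boldsymbol u_h^{n-1}\|_{L^2(\Sigma)}^2+4\mu\Delta t\,\|\varepsilon(\boldsymbol u_h^{n})\|_{L^2(\Omega_f)}^2+2h^2\Delta t\,\|\nabla p_h^{n}\|_{L^2(\Omega_f)}^2 .$$ Then the following energy identity holds: $$\mathcal S_h^{M}+\sum_{m=1}^M\mathcal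 Z_h^m=\mathcal S_h^{0}\qquad\text{for } 1\le M\le N.$$
   Context: **Geometry and parameters.** $\Omega_s,\Omega_f\subset\mathbb R^2$ are two non-overlapping polygonal domains (solid and fluid) with matching interface $\Sigma=\partial\Omega_s\cap\partial\Omega_f$, assumed to be a straight segment; $\Sigma_i=\partial\Omega_i\setminus\Sigma$, $i=s,f$. The constants satisfy $\rho_s,\rho_f,\mu,L_1>0$, $L_2\ge0$, and $\alpha>0$ is the Robin parameter. $\varepsilon(\boldsymbol v)$ is the symmetric gradient; $(\cdot,\cdot)_i$ is the $L^2$ inner product on $\Omega_i$ and $\langle\cdot,\cdot\rangle$ the $L^2$ inner product on $\Sigma$. **Time grid.** $T=N\Delta t$, $t_n=n\Delta t$; $\partial_{\Delta t}f^{n+1}:=\frac1{\Delta t}(f^{n+1}-f^n)$ and $f^{n+1/2}:=\frac12(f^{n+1}+f^n)$. **Finite element spaces.** $\mathcal T_h^i$ is a shape-regular, quasi-uniform simplicial triangulation of $\Omega_i$ ($i=s,f$) of mesh size $h$; the two meshes match on $\Sigma$. $\boldsymbol V_h^i$ is the space of continuous, $\mathbb R^2$-valued functions on $\Omega_i$, affine on each $K\in\mathcal T_h^i$, vanishing on $\Sigma_i$. $M_h^f$ is the space of continuous scalar functions on $\Omega_f$, affine on each $K\in\mathcal T_h^f$, with zero mean over $\Omega_f$. $\boldsymbol V_h^g$ is the space of traces on $\Sigma$ of functions of $\boldsymbol V_h^f$ (equal to the space of traces on $\Sigma$ of functions of $\boldsymbol V_h^s$). $\mathcal L_h:\boldsymbol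 V_h^g\to\boldsymbol V_h^f$ is the lifting such that $(\mathcal L_h\boldsymbol\mu_h)|_\Sigma=\boldsymbol\mu_h$ and all nodal values of $\mathcal L_h\boldsymbol\mu_h$ off $\Sigma$ vanish. **Forms.** $a_s(\boldsymbol\eta,\boldsymbol\xi)=2L_1(\varepsilon(\boldsymbol\eta),\varepsilon(\boldsymbol\xi))_s+L_2(\operatorname{div}\boldsymbol\eta,\operatorname{div}\boldsymbol\xi)_s$, $\|\boldsymbol\eta\|_S^2:=a_s(\boldsymbol\eta,\boldsymbol\eta)$, and $a_{f,h}((\boldsymbol u,p),(\boldsymbol v,\theta))=2\mu(\varepsilon(\boldsymbol u),\varepsilon(\boldsymbol v))_f-(p,\operatorname{div}\boldsymbol v)_f+(\operatorname{div}\boldsymbol u,\theta)_f+h^2(\nabla p,\nabla\theta)_f$. **Scheme.** Given initial values $\boldsymbol q_h^0,\boldsymbol\eta_h^0\in\boldsymbol V_h^s$, $\boldsymbol u_h^0\in\boldsymbol V_h^f$, $\boldsymbol\lambda_h^0\in\boldsymbol V_h^g$, for $n=0,\dots,N-1$: 1. (Solid) find $\boldsymbol q_h^{n+1},\boldsymbol\eta_h^{n+1}\in\boldsymbol V_h^s$ with $\boldsymbol q_h^{n+1/2}=\partial_{\Delta t}\boldsymbol\eta_h^{n+1}$ and, for all $\boldsymbol\xi_h\in\boldsymbol V_h^s$, $\rho_s(\partial_{\Delta t}\boldsymbol q_h^{n+1},\boldsymbol\xi_h)_s+a_s(\boldsymbol\eta_h^{n+1/2},\boldsymbol\xi_h)+\alpha\langle\boldsymbol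 q_h^{n+1/2}-\boldsymbol u_h^n,\boldsymbol\xi_h\rangle+\langle\boldsymbol\lambda_h^n,\boldsymbol\xi_h\rangle=0$. 2. (Fluid) find $\boldsymbol u_h^{n+1}\in\boldsymbol V_h^f$, $p_h^{n+1}\in M_h^f$ such that, for all $(\boldsymbol v_h,\theta_h)\in\boldsymbol V_h^f\times M_h^f$, $\rho_f(\partial_{\Delta t}\boldsymbol u_h^{n+1},\boldsymbol v_h)_f+a_{f,h}((\boldsymbol u_h^{n+1},p_h^{n+1}),(\boldsymbol v_h,\theta_h))+\alpha\langle\boldsymbol u_h^{n+1}-\boldsymbol q_h^{n+1/2},\boldsymbol v_h\rangle-\langle\boldsymbol\lambda_h^n,\boldsymbol v_h\rangle=0$. 3. (Stress) find $\boldsymbol\lambda_h^{n+1}\in\boldsymbol V_h^g$ such that, for all $\boldsymbol\mu_h\in\boldsymbol V_h^g$, $\langle\boldsymbol\lambda_h^{n+1},\boldsymbol\mu_h\rangle=\rho_f(\partial_{\Delta t}\boldsymbol u_h^{n+1},\mathcal L_h\boldsymbol\mu_h)_f+a_{f,h}((\boldsymbol u_h^{n+1},p_h^{n+1}),(\mathcal L_h\boldsymbol\mu_h,0))$. *)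

theory Defs
  imports "HOL-Analysis.Analysis"
begin

text \<open>
  Throughout, a function on a set \<open>S\<close> is represented by a function on the whole plane of which only
  the values on \<open>S\<close> matter; the spaces below do not constrain its values elsewhere.
\<close>

type_synonym vec_field = "real^2 \<Rightarrow> real^2"

section \<open>Polygonal domains and meshes\<close>

definition closed_polygon :: "(real^2) set \<Rightarrow> bool" where
  "closed_polygon C \<longleftrightarrow>
     (\<exists>g. simple_path g \<and> pathfinish g = pathstart g \<and> path_image g = C) \<and>
     (\<exists>F. finite F \<and> C = (\<Union>(x, y)\<in>F. closed_segment x y))"

text \<open>
  Several boundary components (holes) are allowed. The condition \<open>interior (closure \<Omega>) = \<Omega>\<close> says that
  the domain lies on one side of its boundary only.
\<close>

definition polygonal_domain :: "(real^2) set \<Rightarrow> bool" where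
  "polygonal_domain \<Omega> \<longleftrightarrow>
     \<Omega> \<noteq> {} \<and> open \<Omega> \<and> connected \<Omega> \<and> bounded \<Omega> \<and> interior (closure \<Omega>) = \<Omega> \<and>
     (\<exists>\<C>. finite \<C> \<and> (\<forall>C\<in>\<C>. closed_polygon C) \<and> pairwise disjnt \<C> \<and> frontier \<Omega> = \<Union>\<C>)"

text \<open>The library predicate \<^const>\<open>triangulation\<close> contains the conformity of the simplices.\<close>

definition simplicial_mesh :: "(real^2) set \<Rightarrow> (real^2) set set \<Rightarrow> bool" where
  "simplicial_mesh \<Omega> \<T> \<longleftrightarrow> triangulation \<T> \<and> (\<forall>K\<in>\<T>. 2 simplex K) \<and> \<Union>\<T> = closure \<Omega>"

definition shape_regular :: "real \<Rightarrow> (real^2) set set \<Rightarrow> bool" where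
  "shape_regular \<kappa> \<T> \<longleftrightarrow> (\<forall>K\<in>\<T>. \<exists>c r. 0 < r \<and> cball c r \<subseteq> K \<and> diameter K \<le> \<kappa> * r)"

definition quasi_uniform :: "real \<Rightarrow> real \<Rightarrow> (real^2) set set \<Rightarrow> bool" where
  "quasi_uniform \<kappa> h \<T> \<longleftrightarrow> (\<forall>K\<in>\<T>. diameter K \<le> h \<and> h \<le> \<kappa> * diameter K)"

definition nodes :: "(real^2) set set \<Rightarrow> (real^2) set" where
  "nodes \<T> = {z. \<exists>K\<in>\<T>. z extreme_point_of K}"

definition edges_on :: "(real^2) set \<Rightarrow> (real^2) set set \<Rightarrow> (real^2) set set" where
  "edges_on \<Sigma> \<T> = {e. e \<subseteq> \<Sigma> \<and> (\<exists>K\<in>\<T>. e edge_of K)}"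

definition meshes_match :: "(real^2) set \<Rightarrow> (real^2) set set \<Rightarrow> (real^2) set set \<Rightarrow> bool" where
  "meshes_match \<Sigma> \<T> \<T>' \<longleftrightarrow> edges_on \<Sigma> \<T> = edges_on \<Sigma> \<T>' \<and> \<Union>(edges_on \<Sigma> \<T>) = \<Sigma>"

section \<open>Inner products and differential operators\<close>

definition L2 :: "(real^2) set \<Rightarrow> (real^2 \<Rightarrow> 'b::real_inner) \<Rightarrow> (real^2 \<Rightarrow> 'b) \<Rightarrow> real" where
  "L2 \<Omega> f g = (LINT x:\<Omega>|lebesgue. f x \<bullet> g x)"

definition L2_norm :: "(real^2) set \<Rightarrow> (real^2 \<Rightarrow> 'b::real_inner) \<Rightarrow> real" where
  "L2_norm \<Omega> f = sqrt (L2 \<Omega> f f)"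

text \<open>
  The inner product on the segment from \<open>a\<close> to \<open>b\<close> with respect to arc length; \<open>dist a b\<close> is the speed of
  the parametrization \<^term>\<open>linepath a b\<close>.
\<close>

definition L2_seg :: "real^2 \<Rightarrow> real^2 \<Rightarrow> vec_field \<Rightarrow> vec_field \<Rightarrow> real" where
  "L2_seg a b f g = dist a b * (LINT t:{0..1}|lebesgue. f (linepath a b t) \<bullet> g (linepath a b t))"

definition L2_seg_norm :: "real^2 \<Rightarrow> real^2 \<Rightarrow> vec_field \<Rightarrow> real" where
  "L2_seg_norm a b f = sqrt (L2_seg a b f f)"

text \<open>
  For continuous piecewise affine functions the weak derivatives are the classical ones, which exist in
  the interior of every element, hence almost everywhere; the arbitrary value that
  \<^const>\<open>frechet_derivative\<close> has on the mesh edges does not affect the integrals.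
  The inner product of type \<open>real^2^2\<close> is the Frobenius product.
\<close>

definition sym_grad :: "vec_field \<Rightarrow> real^2 \<Rightarrow> real^2^2" where
  "sym_grad v x = (1/2) *\<^sub>R (jacobian v (at x) + transpose (jacobian v (at x)))"

definition divg :: "vec_field \<Rightarrow> real^2 \<Rightarrow> real" where
  "divg v x = trace (jacobian v (at x))"

definition grad :: "(real^2 \<Rightarrow> real) \<Rightarrow> real^2 \<Rightarrow> real^2" where
  "grad p x = (\<chi> i. frechet_derivative p (at x) (axis i 1))"

section \<open>Finite element spaces\<close>

definition affine_on_elements :: "(real^2) set set \<Rightarrow> (real^2 \<Rightarrow> 'b::real_vector) \<Rightarrow> bool" where
  "affine_on_elements \<T> v \<longleftrightarrow> (\<forall>K\<in>\<T>. \<exists>A c. linear A \<and> (\<forall>x\<in>K. v x = A x + c))"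

definition V_space :: "(real^2) set \<Rightarrow> (real^2) set \<Rightarrow> (real^2) set set \<Rightarrow> vec_field set" where
  "V_space \<Omega> \<Sigma> \<T> = {v. continuous_on (closure \<Omega>) v \<and> affine_on_elements \<T> v \<and>
                      (\<forall>x \<in> frontier \<Omega> - \<Sigma>. v x = 0)}"

definition M_space :: "(real^2) set \<Rightarrow> (real^2) set set \<Rightarrow> (real^2 \<Rightarrow> real) set" where
  "M_space \<Omega> \<T> = {p. continuous_on (closure \<Omega>) p \<and> affine_on_elements \<T> p \<and>
                    (LINT x:\<Omega>|lebesgue. p x) = 0}"

definition trace_space :: "(real^2) set \<Rightarrow> vec_field set \<Rightarrow> vec_field set" where
  "trace_space \<Sigma> V = {m. \<exists>v\<in>V. \<forall>x\<in>\<Sigma>. m x = v x}"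

text \<open>The choice is unique on the domain; \<open>SOME\<close> only fixes the irrelevant values outside.\<close>

definition lifting :: "(real^2) set \<Rightarrow> (real^2) set \<Rightarrow> (real^2) set set \<Rightarrow> vec_field \<Rightarrow> vec_field" where
  "lifting \<Omega> \<Sigma> \<T> m =
     (SOME w. w \<in> V_space \<Omega> \<Sigma> \<T> \<and> (\<forall>x\<in>\<Sigma>. w x = m x) \<and> (\<forall>z \<in> nodes \<T> - \<Sigma>. w z = 0))"

section \<open>Bilinear forms and time differences\<close>

definition a_solid :: "real \<Rightarrow> real \<Rightarrow> (real^2) set \<Rightarrow> vec_field \<Rightarrow> vec_field \<Rightarrow> real" where
  "a_solid L\<^sub>1 L\<^sub>2 \<Omega> \<eta> \<xi> =
     2 * L\<^sub>1 * L2 \<Omega> (sym_grad \<eta>) (sym_grad \<xi>) + L\<^sub>2 * L2 \<Omega> (divg \<eta>) (divg \<xi>)"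

definition a_fluid :: "real \<Rightarrow> real \<Rightarrow> (real^2) set \<Rightarrow> vec_field \<times> (real^2 \<Rightarrow> real) \<Rightarrow>
    vec_field \<times> (real^2 \<Rightarrow> real) \<Rightarrow> real" where
  "a_fluid \<mu> h \<Omega> = (\<lambda>(u, p) (v, \<theta>).
     2 * \<mu> * L2 \<Omega> (sym_grad u) (sym_grad v) - L2 \<Omega> p (divg v) + L2 \<Omega> (divg u) \<theta>
       + h\<^sup>2 * L2 \<Omega> (grad p) (grad \<theta>))"

text \<open>
  \<open>ddt dt f n\<close> is the backward difference quotient ending at level \<open>n\<close> (used for \<open>n \<ge> 1\<close> only), and
  \<open>mid f n\<close> is the average of the levels \<open>n\<close> and \<open>n + 1\<close>, i.e. the value at level \<open>n + 1/2\<close>.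
\<close>

definition ddt :: "real \<Rightarrow> (nat \<Rightarrow> vec_field) \<Rightarrow> nat \<Rightarrow> vec_field" where
  "ddt dt f n = (\<lambda>x. (1 / dt) *\<^sub>R (f n x - f (n - 1) x))"

definition mid :: "(nat \<Rightarrow> vec_field) \<Rightarrow> nat \<Rightarrow> vec_field" where
  "mid f n = (\<lambda>x. (1 / 2) *\<^sub>R (f (n + 1) x + f n x))"

end

theory Submission
  imports Defs
begin

text \<open>
  The identity is the sum over the time steps of a one-step balance \<open>S (n + 1) + Z (n + 1) = S n\<close>. To
  obtain it, test the solid equation with the half-step velocity, which equals the difference quotient of
  the displacement, and the fluid equation with the new velocity and pressure. The kinetic and elastic
  terms of the solid become increments of squares (\<open>L2_average_increment\<close>, \<open>a_solid_average_increment\<close>),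
  the fluid inertia does so up to the square of the increment (\<open>L2_increment_final\<close>), the two pressure
  terms cancel, and viscosity and pressure stabilization remain as dissipation.

  What is left is work at the interface. Testing the fluid equation with liftings and comparing with the
  definition of the new stress shows that, weakly on \<open>\<Sigma>\<close>, the stress changes by \<open>- \<alpha>\<close> times the difference
  of the new fluid velocity and the half-step solid velocity. With this relation the interface work is an
  increment of the interface energy plus the slip term in \<open>Z\<close> (\<open>interface_work_identity\<close>).

  Weakly means: for test functions in the space of fluid traces. The argument tests with the solid
  velocity too, and it uses that the chosen lifting really is a lifting. Both rest on one fact of discrete
  geometry (\<open>extension_by_zero_nodal_values\<close>): the values on \<open>\<Sigma>\<close> of a finite element function from either
  side extend to a fluid finite element function that vanishes at all nodes off \<open>\<Sigma>\<close>. A piecewise affine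
  extension exists by nodal interpolation, but it has to satisfy the boundary condition on boundary edges
  off \<open>\<Sigma>\<close> that end on \<open>\<Sigma>\<close>. The boundary consists of disjoint simple closed curves, one of which contains the
  segment \<open>\<Sigma>\<close>, so such edges can meet \<open>\<Sigma>\<close> only at its two ends
  (\<open>closure_frontier_minus_interface\<close>), and there all functions in question vanish.
\<close>

section \<open>A straight segment inside a polygonal boundary\<close>

text \<open>
  An arc has a continuous inverse. It carries the set to a connected subset of the unit interval that
  contains \<open>0\<close> and \<open>1\<close>, hence to the whole interval.
\<close>

lemma connected_subset_arc_with_endpoints:
  fixes u :: "real \<Rightarrow> 'a::t2_space"
  assumes "arc u" "connected S" "S \<subseteq> path_image u" "pathstart u \<in> S" "pathfinish u \<in> S"
  shows "S = path_image u"
proof -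
  obtain h where h: "homeomorphism {0..1} (path_image u) u h"
    using homeomorphism_arc [OF \<open>arc u\<close>] by blast
  have "connected (h ` S)"
    by (meson assms(2,3) connected_continuous_image continuous_on_subset h homeomorphism_def)
  moreover have "h (u 0) = 0" "h (u 1) = 1"
    using h by (simp_all add: homeomorphism_apply1)
  then have "0 \<in> h ` S" "1 \<in> h ` S"
    using assms(4,5) unfolding pathstart_def pathfinish_def by (metis imageI)+
  ultimately have "{0..1} \<subseteq> h ` S"
    by (simp add: connected_contains_Icc)
  then have "u ` {0..1} \<subseteq> u ` h ` S"
    by blast
  also have "u ` h ` S = (\<lambda>y. y) ` S"
    unfolding image_image
    by (rule image_cong [OF refl]) (use homeomorphism_apply2 [OF h] assms(3) in blast)
  finally show ?thesis
    using assms(3) by (auto simp: path_image_def)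
qed

text \<open>
  The points \<open>a\<close> and \<open>b\<close> cut the curve into two arcs that meet only at their ends. The open segment is
  connected and avoids these ends, so it lies in one of the arcs and, by the previous lemma, fills it.
  The other arc is the remainder of the curve.
\<close>

lemma complementary_arc_of_segment:
  fixes g :: "real \<Rightarrow> 'a::euclidean_space"
  assumes "simple_path g" "pathfinish g = pathstart g" "closed_segment a b \<subseteq> path_image g" "a \<noteq> b"
  obtains d where "arc d" "{pathstart d, pathfinish d} = {a, b}"
    "path_image d \<inter> closed_segment a b = {a, b}"
    "path_image g = closed_segment a b \<union> path_image d"
proof -
  have ab: "a \<in> path_image g" "b \<in> path_image g"
    using assms(3) by auto
  obtain u d where ud: "arc u" "arc d" "pathstart u = a" "pathfinish u = b"
      "pathstart d = b" "pathfinish d = a"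
      "path_image u \<inter> path_image d = {a, b}" "path_image u \<union> path_image d = path_image g"
    using exists_double_arc [OF assms(1,2) ab \<open>a \<noteq> b\<close>] by metis
  have cl: "closed (path_image u)" "closed (path_image d)"
    by (simp_all add: closed_arc_image ud)
  have "connected (open_segment a b)"
    by (simp add: convex_connected)
  moreover have "open_segment a b \<subseteq> path_image u \<union> path_image d"
    using ud(8) assms(3) segment_open_subset_closed by blast
  moreover have "path_image u \<inter> path_image d \<inter> open_segment a b = {}"
    using ud(7) by (auto simp: open_segment_def)
  ultimately have "path_image u \<inter> open_segment a b = {} \<or> path_image d \<inter> open_segment a b = {}"
    using cl unfolding connected_closed by blast
  then have "open_segment a b \<subseteq> path_image u \<or> open_segment a b \<subseteq> path_image d"
    using \<open>open_segment a b \<subseteq> path_image u \<union> path_image d\<close> by blast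
  moreover have "{a, b} \<subseteq> path_image u" "{a, b} \<subseteq> path_image d"
    using ud(7) by blast+
  ultimately consider "closed_segment a b \<subseteq> path_image u" | "closed_segment a b \<subseteq> path_image d"
    using closed_segment_eq_open by (metis Un_least)
  then show thesis
  proof cases
    case 1
    then have seg: "closed_segment a b = path_image u"
      by (rule connected_subset_arc_with_endpoints [OF ud(1) connected_segment(1)]) (simp_all add: ud)
    show ?thesis
    proof (rule that [OF ud(2)])
      show "{pathstart d, pathfinish d} = {a, b}"
        unfolding ud(5,6) by blast
      show "path_image d \<inter> closed_segment a b = {a, b}"
        unfolding seg ud(7) [symmetric] by blast
    qed (simp add: seg ud(8))
  next
    case 2
    then have seg: "closed_segment a b = path_image d"
      by (rule connected_subset_arc_with_endpoints [OF ud(2) connected_segment(1)]) (simp_all add: ud)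
    show ?thesis
    proof (rule that [OF ud(1)])
      show "{pathstart u, pathfinish u} = {a, b}"
        unfolding ud(3,4) by blast
      show "path_image u \<inter> closed_segment a b = {a, b}"
        unfolding seg ud(7) ..
      show "path_image g = closed_segment a b \<union> path_image u"
        unfolding seg ud(8) [symmetric] by blast
    qed
  qed
qed

text \<open>
  This is where the boundary being a disjoint union of simple closed curves enters: at a relatively
  interior point of the segment no other branch of the boundary arrives. It fails for a domain that is
  pinched at such a point. Both inclusions matter below: a continuous function that vanishes on the rest of the
  boundary is forced to vanish at \<open>a\<close> and \<open>b\<close>, and at no other point of the segment.
\<close>

lemma closure_frontier_minus_interface:
  assumes "polygonal_domain \<Omega>" "closed_segment a b \<subseteq> frontier \<Omega>" "a \<noteq> b"
  shows "closure (frontier \<Omega> - closed_segment a b) \<inter> closed_segment a b = {a, b}"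
proof -
  obtain \<C> where \<C>: "finite \<C>" "\<forall>C\<in>\<C>. closed_polygon C" "pairwise disjnt \<C>" "frontier \<Omega> = \<Union>\<C>"
    using assms(1) unfolding polygonal_domain_def by blast
  have closed_polygon: "closed C" if "C \<in> \<C>" for C
    using \<C>(2) that unfolding closed_polygon_def
    by (metis closed_path_image simple_path_imp_path)
  have "a \<in> \<Union>\<C>"
    using assms(2) \<C>(4) by auto
  then obtain C where C: "C \<in> \<C>" "a \<in> C"
    by blast
  define B where "B = \<Union>(\<C> - {C})"
  have B: "closed B" "C \<inter> B = {}" "frontier \<Omega> = C \<union> B"
    using \<C> C closed_polygon unfolding B_def by (auto simp: pairwise_def disjnt_def)
  have "closed_segment a b \<subseteq> C \<union> B" "C \<inter> closed_segment a b \<noteq> {}"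
    using assms(2) B(3) C(2) by auto
  then have "B \<inter> closed_segment a b = {}"
    using connected_segment(1) [of a b] B(1,2) closed_polygon [OF C(1)]
    unfolding connected_closed by blast
  then have seg: "closed_segment a b \<subseteq> C"
    using \<open>closed_segment a b \<subseteq> C \<union> B\<close> by blast
  obtain g where g: "simple_path g" "pathfinish g = pathstart g" "path_image g = C"
    using \<C>(2) C(1) unfolding closed_polygon_def by blast
  obtain d where d: "arc d" "{pathstart d, pathfinish d} = {a, b}"
      "path_image d \<inter> closed_segment a b = {a, b}" "C = closed_segment a b \<union> path_image d"
    using complementary_arc_of_segment [OF g(1,2)] seg assms(3) g(3) by metis
  have "closure (frontier \<Omega> - closed_segment a b) \<subseteq> path_image d \<union> B"
    using B(3) d(4) closed_Un [OF closed_arc_image [OF d(1)] B(1)] by (intro closure_minimal) auto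
  moreover have "{a, b} \<subseteq> closure (frontier \<Omega> - closed_segment a b)"
  proof -
    have "d ` {0<..<1} = path_image d - {a, b}"
      using simple_path_endless [OF arc_imp_simple_path [OF d(1)]] d(2) by simp
    also have "\<dots> \<subseteq> frontier \<Omega> - closed_segment a b"
      unfolding B(3) d(4) using d(3) by blast
    finally have "d ` {0<..<1} \<subseteq> closure (frontier \<Omega> - closed_segment a b)"
      using closure_subset by (rule subset_trans)
    moreover have "continuous_on (closure {0<..<1}) d"
      using d(1) by (simp add: arc_def path_def)
    ultimately have "d ` closure {0<..<1} \<subseteq> closure (frontier \<Omega> - closed_segment a b)"
      by (intro image_closure_subset) auto
    then have "path_image d \<subseteq> closure (frontier \<Omega> - closed_segment a b)"
      by (simp add: path_image_def)
    then show ?thesis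
      using d(3) by blast
  qed
  ultimately show ?thesis
    using \<open>B \<inter> closed_segment a b = {}\<close> d(3) by blast
qed

section \<open>Open faces of a mesh and the boundary of the domain\<close>

text \<open>
  A polyhedron looks the same from any two relatively interior points of a piece \<open>F\<close>, because a defining
  half-space is tight at either both or neither of them: a linear functional that attains its maximum
  over \<open>F\<close> at a relatively interior point is constant on \<open>F\<close>.
\<close>

lemma polyhedron_local_translation:
  fixes P F :: "'a::euclidean_space set"
  assumes "polyhedron P" "F \<subseteq> P" "x \<in> rel_interior F" "y \<in> rel_interior F"
  shows "\<forall>\<^sub>F d in nhds 0. x + d \<in> P \<longleftrightarrow> y + d \<in> P"
proof -
  obtain H where H: "finite H" "P = \<Inter>H" "\<forall>h\<in>H. \<exists>a b. a \<noteq> 0 \<and> h = {x. a \<bullet> x \<le> b}"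
    using assms(1) unfolding polyhedron_def by blast
  have "\<forall>\<^sub>F d in nhds 0. x + d \<in> h \<longleftrightarrow> y + d \<in> h" if hH: "h \<in> H" for h
  proof -
    obtain a b where h: "h = {x. a \<bullet> x \<le> b}"
      using bspec [OF H(3) hH] by auto
    have sub: "F \<subseteq> h"
      using assms(2) H(2) hH by blast
    have face: "(h \<inter> {x. a \<bullet> x = b}) face_of h"
      unfolding h by (rule face_of_Int_supporting_hyperplane_le [OF convex_halfspace_le]) simp
    have xy: "x \<in> F" "y \<in> F"
      using assms(3,4) rel_interior_subset by auto
    \<comment> \<open>The bounding plane cuts out a face of \<open>h\<close>; if this face meets the relative interior of \<open>F\<close>, it
      contains \<open>F\<close>.\<close>
    have on_plane: "F \<subseteq> {x. a \<bullet> x = b}" if "z \<in> rel_interior F" "a \<bullet> z = b" for z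
    proof -
      have "z \<in> h"
        using that(2) by (simp add: h)
      then have "(h \<inter> {x. a \<bullet> x = b}) \<inter> rel_interior F \<noteq> {}"
        using that by auto
      then show ?thesis
        using subset_of_face_of [OF face sub] by simp
    qed
    have tight: "a \<bullet> x = b \<longleftrightarrow> a \<bullet> y = b"
      using on_plane [OF assms(3)] on_plane [OF assms(4)] xy by auto
    show ?thesis
    proof (cases "a \<bullet> x = b")
      case True
      then show ?thesis
        using tight by (simp add: h inner_add_right)
    next
      case False
      then have "a \<bullet> (x + 0) < b" "a \<bullet> (y + 0) < b"
        using tight xy sub h by (auto simp: less_le)
      moreover have "((\<lambda>d. a \<bullet> (z + d)) \<longlongrightarrow> a \<bullet> (z + 0)) (nhds 0)" for z
        by (intro tendsto_intros filterlim_ident)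
      ultimately have "\<forall>\<^sub>F d in nhds 0. a \<bullet> (x + d) < b" "\<forall>\<^sub>F d in nhds 0. a \<bullet> (y + d) < b"
        using order_tendstoD(2) by blast+
      then show ?thesis
        by eventually_elim (auto simp: h)
    qed
  qed
  then have "\<forall>\<^sub>F d in nhds 0. \<forall>h\<in>H. x + d \<in> h \<longleftrightarrow> y + d \<in> h"
    using H(1) by (simp add: eventually_ball_finite_distrib)
  then show ?thesis
    by eventually_elim (use H(2) in auto)
qed

lemma triangulation_face_subset:
  assumes "triangulation \<T>" "K \<in> \<T>" "K' \<in> \<T>" "F face_of K" "x \<in> rel_interior F" "x \<in> K'"
  shows "F \<subseteq> K'"
proof -
  have "(K \<inter> K') face_of K" "F \<subseteq> K" "x \<in> K \<inter> K'"
    using assms unfolding triangulation_def by (auto dest: face_of_imp_subset rel_interior_subset [THEN subsetD])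
  then show ?thesis
    using subset_of_face_of [of "K \<inter> K'" K F] assms(5) by blast
qed

text \<open>
  By conformity every simplex contains all of \<open>F\<close> or misses its relative interior, so the preceding
  lemma applies to each simplex separately.
\<close>

lemma triangulation_local_translation:
  assumes "triangulation \<T>" "K \<in> \<T>" "F face_of K" "x \<in> rel_interior F" "y \<in> rel_interior F"
  shows "\<forall>\<^sub>F d in nhds 0. x + d \<in> \<Union>\<T> \<longleftrightarrow> y + d \<in> \<Union>\<T>"
proof -
  have "\<forall>\<^sub>F d in nhds 0. x + d \<in> K' \<longleftrightarrow> y + d \<in> K'" if K': "K' \<in> \<T>" for K'
  proof (cases "F \<subseteq> K'")
    case True
    have "polyhedron K'"
      using assms(1) K' simplex_imp_polyhedron unfolding triangulation_def by blast
    then show ?thesis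
      using polyhedron_local_translation True assms(4,5) by blast
  next
    case False
    have "closed K'"
      using assms(1) K' closed_simplex unfolding triangulation_def by blast
    moreover have "x \<notin> K'" "y \<notin> K'"
      using triangulation_face_subset [OF assms(1,2) K' assms(3)] assms(4,5) False by blast+
    moreover have "\<forall>\<^sub>F d in nhds 0. z + d \<in> - K'" if "z \<notin> K'" for z
    proof (rule topological_tendstoD)
      show "((\<lambda>d. z + d) \<longlongrightarrow> z + 0) (nhds 0)"
        by (intro tendsto_intros filterlim_ident)
    qed (use \<open>closed K'\<close> that in auto)
    ultimately have "\<forall>\<^sub>F d in nhds 0. x + d \<in> - K'" "\<forall>\<^sub>F d in nhds 0. y + d \<in> - K'"
      by blast+
    then show ?thesis
      by eventually_elim auto
  qed
  then have "\<forall>\<^sub>F d in nhds 0. \<forall>K'\<in>\<T>. x + d \<in> K' \<longleftrightarrow> y + d \<in> K'"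
    using assms(1) by (simp add: eventually_ball_finite_distrib triangulation_def)
  then show ?thesis
    by eventually_elim auto
qed

lemma interior_iff_eventually_translate:
  fixes x :: "'a::real_normed_vector"
  shows "x \<in> interior S \<longleftrightarrow> (\<forall>\<^sub>F d in nhds 0. x + d \<in> S)"
proof -
  have "x \<in> interior S \<longleftrightarrow> (\<forall>\<^sub>F y in nhds x. y \<in> S)"
    unfolding eventually_nhds interior_def by auto
  also have "nhds x = filtermap (\<lambda>d. x + d) (nhds 0)"
    using filtermap_nhds_shift [of "-x" 0] by (simp add: add.commute)
  finally show ?thesis
    by (simp add: eventually_filtermap)
qed

lemma triangulation_interior_open_face:
  assumes "triangulation \<T>" "K \<in> \<T>" "F face_of K" "x \<in> rel_interior F" "y \<in> rel_interior F"
  shows "x \<in> interior (\<Union>\<T>) \<longleftrightarrow> y \<in> interior (\<Union>\<T>)"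
  unfolding interior_iff_eventually_translate
  by (rule eventually_subst [OF triangulation_local_translation [OF assms]])

text \<open>
  Being an interior point of \<open>closure \<Omega>\<close> is a property of the germ of the mesh at the point, which is the
  same along an open face. As \<open>\<Omega>\<close> is the interior of its closure, an open face that meets the boundary
  therefore lies in it.
\<close>

lemma mesh_open_face_subset_frontier:
  assumes "polygonal_domain \<Omega>" "simplicial_mesh \<Omega> \<T>" "K \<in> \<T>" "F face_of K"
    and "x \<in> rel_interior F" "x \<in> frontier \<Omega>"
  shows "rel_interior F \<subseteq> frontier \<Omega>"
proof
  fix y assume y: "y \<in> rel_interior F"
  have \<T>: "triangulation \<T>" "\<Union>\<T> = closure \<Omega>"
    using assms(2) by (auto simp: simplicial_mesh_def)
  have \<Omega>: "interior (closure \<Omega>) = \<Omega>" "interior \<Omega> = \<Omega>"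
    using assms(1) by (auto simp: polygonal_domain_def interior_open)
  have "x \<notin> interior (\<Union>\<T>)"
    using assms(6) \<T> \<Omega> by (simp add: frontier_def)
  then have "y \<notin> interior (\<Union>\<T>)"
    using triangulation_interior_open_face [OF \<T>(1) assms(3,4,5) y] by simp
  moreover have "y \<in> \<Union>\<T>"
    using y assms(3) face_of_imp_subset [OF assms(4)] rel_interior_subset [of F] by auto
  ultimately show "y \<in> frontier \<Omega>"
    unfolding \<T>(2) \<Omega>(1) frontier_def \<Omega>(2) by blast
qed

text \<open>
  The face is spanned by the vertices with positive barycentric coordinates.
\<close>

lemma simplex_carrier_face:
  assumes "n simplex K" "x \<in> K"
  obtains F where "F face_of K" "x \<in> rel_interior F"
proof -
  obtain C where C: "finite C" "\<not> affine_dependent C" "K = convex hull C"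
    using assms(1) by (auto simp: simplex)
  obtain u where u: "\<forall>z\<in>C. 0 \<le> u z" "sum u C = 1" "(\<Sum>z\<in>C. u z *\<^sub>R z) = x"
    using assms(2) C(1,3) by (auto simp: convex_hull_finite)
  define D where "D = {z\<in>C. 0 < u z}"
  have D: "D \<subseteq> C" "finite D" "\<forall>z\<in>C - D. u z = 0"
    using C(1) u(1) by (auto simp: D_def less_le)
  have "sum u D = 1" "(\<Sum>z\<in>D. u z *\<^sub>R z) = x"
    using u(2,3) sum.mono_neutral_left [OF C(1) D(1), of u]
      sum.mono_neutral_left [OF C(1) D(1), of "\<lambda>z. u z *\<^sub>R z"] D(3) by auto
  then have "x \<in> rel_interior (convex hull D)"
    using explicit_subset_rel_interior_convex_hull_minimal [OF D(2)] by (auto simp: D_def)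
  moreover have "(convex hull D) face_of K"
    using C(2,3) D(1) face_of_convex_hull_affine_independent by blast
  ultimately show thesis
    using that by blast
qed

section \<open>Nodal interpolation and extension from the interface\<close>

lemma affine_maps_agree_on_hull:
  fixes A B :: "'a::real_vector \<Rightarrow> 'b::real_vector"
  assumes "linear A" "linear B" "\<And>z. z \<in> C \<Longrightarrow> A z + c = B z + d" "x \<in> convex hull C"
  shows "A x + c = B x + d"
proof -
  have "(\<lambda>x. A x - B x) ` (convex hull C) = convex hull ((\<lambda>x. A x - B x) ` C)"
    by (rule convex_hull_linear_image [OF linear_compose_sub [OF assms(1,2)]])
  also have "\<dots> \<subseteq> convex hull {d - c}"
    using assms(3) by (intro hull_mono) (auto simp: algebra_simps)
  finally have "A x - B x = d - c"
    using assms(4) by auto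
  then show ?thesis
    by (simp add: algebra_simps)
qed

lemma affine_map_with_vertex_values:
  fixes g :: "'a::real_vector \<Rightarrow> 'b::real_vector"
  assumes "\<not> affine_dependent C"
  obtains A c where "linear A" "\<And>z. z \<in> C \<Longrightarrow> A z + c = g z"
proof (cases "C = {}")
  case True
  show thesis
    by (rule that [OF module_hom_zero [unfolded module_hom_iff_linear]]) (simp add: True)
next
  case False
  then obtain a where a: "a \<in> C"
    by blast
  have "independent ((\<lambda>x. - a + x) ` (C - {a}))"
    using assms a affine_dependent_iff_dependent2 by blast
  then obtain A where A: "linear A"
      "\<forall>y\<in>(\<lambda>x. - a + x) ` (C - {a}). A y = g (a + y) - g a"
    using linear_independent_extend [of "(\<lambda>x. - a + x) ` (C - {a})" "\<lambda>y. g (a + y) - g a"] by blast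
  have "A z + (g a - A a) = g z" if "z \<in> C" for z
  proof (cases "z = a")
    case False
    then have "A (- a + z) = g z - g a"
      using A(2) that by force
    moreover have "A z + (g a - A a) = A (- a + z) + g a"
      using A(1) by (simp add: linear_diff)
    ultimately show ?thesis
      by simp
  qed simp
  then show thesis
    using that A(1) by blast
qed

text \<open>
  On each simplex the vertex values determine an affine map. Two such maps agree on the common face,
  since its vertices are vertices of both simplices; the pieces therefore glue to a continuous function.
\<close>

lemma nodal_interpolation:
  fixes g :: "real^2 \<Rightarrow> 'b::real_normed_vector"
  assumes "triangulation \<T>"
  obtains w where "continuous_on (\<Union>\<T>) w" "affine_on_elements \<T> w" "\<And>z. z \<in> nodes \<T> \<Longrightarrow> w z = g z"
proof -
  have fin: "finite \<T>" and simp: "\<And>K. K \<in> \<T> \<Longrightarrow> \<exists>n. n simplex K"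
    and conf: "\<And>K K'. K \<in> \<T> \<Longrightarrow> K' \<in> \<T> \<Longrightarrow> (K \<inter> K') face_of K"
    using assms by (auto simp: triangulation_def)
  have "\<exists>C. \<not> affine_dependent C \<and> K = convex hull C" if "K \<in> \<T>" for K
    using simp [OF that] by (auto simp: simplex_def)
  then obtain C where C: "\<And>K. K \<in> \<T> \<Longrightarrow> \<not> affine_dependent (C K)" "\<And>K. K \<in> \<T> \<Longrightarrow> K = convex hull C K"
    by metis
  have "\<exists>A c. linear A \<and> (\<forall>z\<in>C K. A z + c = g z)" if "K \<in> \<T>" for K
    using affine_map_with_vertex_values [OF C(1) [OF that], of g] by metis
  then obtain A c where A: "\<And>K. K \<in> \<T> \<Longrightarrow> linear (A K)"
      "\<And>K z. K \<in> \<T> \<Longrightarrow> z \<in> C K \<Longrightarrow> A K z + c K = g z"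
    by metis
  have agree: "A K x + c K = A K' x + c K'" if K: "K \<in> \<T>" "K' \<in> \<T>" "x \<in> K" "x \<in> K'" for K K' x
  proof -
    have "(K \<inter> K') face_of K" "(K \<inter> K') face_of K'"
      using conf [OF K(1,2)] conf [OF K(2,1)] by (simp_all add: Int_commute)
    then obtain D where D: "D \<subseteq> C K" "K \<inter> K' = convex hull D"
      using face_of_convex_hull_affine_independent [OF C(1) [OF K(1)]] C(2) [OF K(1)] by metis
    have "D \<subseteq> C K'"
    proof
      fix z assume z: "z \<in> D"
      then have "z extreme_point_of K"
        using extreme_point_of_convex_hull_affine_independent [OF C(1) [OF K(1)]] C(2) [OF K(1)] D(1)
        by auto
      moreover have zK: "z \<in> K \<inter> K'"
        unfolding D(2) by (simp add: hull_inc z)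
      ultimately have "z extreme_point_of K'"
        using extreme_point_of_face [OF \<open>(K \<inter> K') face_of K\<close>]
          extreme_point_of_face [OF \<open>(K \<inter> K') face_of K'\<close>] by blast
      then show "z \<in> C K'"
        using C(2) [OF K(2)] extreme_point_of_convex_hull by metis
    qed
    then show ?thesis
      using D K affine_maps_agree_on_hull [OF A(1) [OF K(1)] A(1) [OF K(2)], of D "c K" "c K'" x] A(2)
      by (metis Int_iff subsetD)
  qed
  define w where "w x = (let K = (SOME K. K \<in> \<T> \<and> x \<in> K) in A K x + c K)" for x
  have w: "w x = A K x + c K" if K: "K \<in> \<T>" "x \<in> K" for K x
  proof -
    have "(SOME K. K \<in> \<T> \<and> x \<in> K) \<in> \<T> \<and> x \<in> (SOME K. K \<in> \<T> \<and> x \<in> K)"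
      by (rule someI) (use K in blast)
    then show ?thesis
      unfolding w_def Let_def using agree K by blast
  qed
  show thesis
  proof (rule that)
    have "continuous_on (\<Union>K\<in>\<T>. K) w"
    proof (rule continuous_on_closed_Union [OF fin])
      show "closed K" if "K \<in> \<T>" for K
        using simp [OF that] closed_simplex by blast
      show "continuous_on K w" if "K \<in> \<T>" for K
      proof -
        have "continuous_on K (\<lambda>x. A K x + c K)"
          using A(1) [OF that] by (intro continuous_intros linear_continuous_on) (simp add: linear_conv_bounded_linear)
        then show ?thesis
          using w [OF that] by (simp cong: continuous_on_cong)
      qed
    qed
    then show "continuous_on (\<Union>\<T>) w"
      by simp
    show "affine_on_elements \<T> w"
      unfolding affine_on_elements_def using A(1) w by blast
    show "w z = g z" if "z \<in> nodes \<T>" for z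
    proof -
      obtain K where K: "K \<in> \<T>" "z extreme_point_of K"
        using \<open>z \<in> nodes \<T>\<close> by (auto simp: nodes_def)
      then have "z \<in> C K" "z \<in> K"
        using C(2) [OF K(1)] extreme_point_of_convex_hull [of z "C K"] by (auto simp: extreme_point_of_def)
      then show ?thesis
        using w A(2) K(1) by simp
    qed
  qed
qed

text \<open>
  When the interface is a union of mesh edges, no open face can cross it: a face with a relatively
  interior point on one of these edges is contained in that edge.
\<close>

lemma mesh_face_meeting_interface:
  assumes "triangulation \<T>" "\<Union>(edges_on \<Sigma> \<T>) = \<Sigma>"
    and "K \<in> \<T>" "F face_of K" "y \<in> rel_interior F" "y \<in> \<Sigma>"
  shows "F \<subseteq> \<Sigma>"
proof -
  have "y \<in> \<Union>(edges_on \<Sigma> \<T>)"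
    using assms(2,6) by simp
  then obtain e where "y \<in> e" "e \<in> edges_on \<Sigma> \<T>"
    by (rule UnionE)
  then obtain K' where e: "y \<in> e" "e \<subseteq> \<Sigma>" "K' \<in> \<T>" "e face_of K'"
    by (auto simp: edges_on_def edge_of_def)
  have "y \<in> K'"
    using e face_of_imp_subset by blast
  then have "F \<subseteq> K'"
    using triangulation_face_subset [OF assms(1,3) e(3) assms(4,5)] by blast
  moreover have "e \<inter> rel_interior F \<noteq> {}"
    using e(1) assms(5) by blast
  ultimately have "F \<subseteq> e"
    by (rule subset_of_face_of [OF e(4)])
  then show ?thesis
    using e(2) by blast
qed

lemma simplex_face_vertices:
  assumes "n simplex K" "F face_of K"
  obtains D where "F = convex hull D" "\<And>z. z \<in> D \<Longrightarrow> z extreme_point_of K"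
proof -
  obtain C where C: "\<not> affine_dependent C" "K = convex hull C"
    using assms(1) by (auto simp: simplex)
  then obtain D where "D \<subseteq> C" "F = convex hull D"
    using assms(2) face_of_convex_hull_affine_independent by metis
  then show thesis
    using that C extreme_point_of_convex_hull_affine_independent by blast
qed

text \<open>
  The boundary values are zero on the rest of the boundary, and both ends of the interface are limits
  of points of that rest.
\<close>

lemma V_space_vanishes_at_endpoints:
  assumes "polygonal_domain \<Omega>" "closed_segment a b \<subseteq> frontier \<Omega>" "a \<noteq> b"
    and "v \<in> V_space \<Omega> (closed_segment a b) \<T>"
  shows "v a = 0" "v b = 0"
proof -
  let ?R = "frontier \<Omega> - closed_segment a b"
  have v: "continuous_on (closure \<Omega>) v" "\<forall>x\<in>?R. v x = 0"
    using assms(4) by (auto simp: V_space_def)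
  have sub: "closure ?R \<subseteq> closure \<Omega>"
    by (rule closure_minimal) (auto simp: frontier_def)
  have "v ` closure ?R \<subseteq> {0}"
    using v(2) by (intro image_closure_subset continuous_on_subset [OF v(1) sub]) auto
  moreover have "{a, b} \<subseteq> closure ?R"
    using closure_frontier_minus_interface [OF assms(1-3)] by blast
  ultimately show "v a = 0" "v b = 0"
    by auto
qed

text \<open>
  The extension is the interpolant of \<open>v\<close> at the nodes on \<open>\<Sigma>\<close> and of zero at all other nodes. Taking for
  \<open>\<T>'\<close> the same mesh shows that the discrete lifting exists; taking the mesh on the other side of \<open>\<Sigma>\<close>
  shows that both sides have the same traces.

  The delicate point is the boundary condition, since a boundary face off \<open>\<Sigma>\<close> may have a vertex on \<open>\<Sigma>\<close>.
  Such a vertex is a limit of points of the boundary off \<open>\<Sigma>\<close>, so it is an end of \<open>\<Sigma>\<close>, where \<open>v\<close> vanishes.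
\<close>

lemma extension_by_zero_nodal_values:
  assumes dom: "polygonal_domain \<Omega>" and mesh: "simplicial_mesh \<Omega> \<T>"
    and seg: "\<Sigma> = closed_segment a b" "a \<noteq> b" "\<Sigma> \<subseteq> frontier \<Omega>"
    and match: "edges_on \<Sigma> \<T> = edges_on \<Sigma> \<T>'" "\<Union>(edges_on \<Sigma> \<T>) = \<Sigma>"
    and v: "affine_on_elements \<T>' v" "v a = 0" "v b = 0"
  obtains w where "w \<in> V_space \<Omega> \<Sigma> \<T>" "\<And>x. x \<in> \<Sigma> \<Longrightarrow> w x = v x" "\<And>z. z \<in> nodes \<T> - \<Sigma> \<Longrightarrow> w z = 0"
proof -
  have \<T>: "triangulation \<T>" "\<Union>\<T> = closure \<Omega>" "\<And>K. K \<in> \<T> \<Longrightarrow> 2 simplex K"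
    using mesh by (auto simp: simplicial_mesh_def)
  obtain w where w: "continuous_on (\<Union>\<T>) w" "affine_on_elements \<T> w"
      "\<And>z. z \<in> nodes \<T> \<Longrightarrow> w z = (if z \<in> \<Sigma> then v z else 0)"
    using nodal_interpolation [OF \<T>(1), of "\<lambda>z. if z \<in> \<Sigma> then v z else 0"] by blast
  have trace: "w x = v x" if x: "x \<in> \<Sigma>" for x
  proof -
    have "x \<in> \<Union>(edges_on \<Sigma> \<T>)"
      using x match(2) by simp
    then obtain e where "x \<in> e" "e \<in> edges_on \<Sigma> \<T>"
      by (rule UnionE)
    moreover from this have "e \<in> edges_on \<Sigma> \<T>'" "e \<subseteq> \<Sigma>"
      using match(1) by (simp, simp add: edges_on_def)
    ultimately have e: "x \<in> e" "e \<subseteq> \<Sigma>" "e \<in> edges_on \<Sigma> \<T>" "e \<in> edges_on \<Sigma> \<T>'"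
      by simp_all
    obtain K where K: "K \<in> \<T>" "e face_of K"
      using e(3) by (auto simp: edges_on_def edge_of_def)
    obtain K' where K': "K' \<in> \<T>'" "e \<subseteq> K'"
      using e(4) edge_of_imp_subset by (auto simp: edges_on_def)
    obtain A c where A: "linear A" "\<And>x. x \<in> K \<Longrightarrow> w x = A x + c"
      using w(2) K(1) unfolding affine_on_elements_def by blast
    obtain B d where B: "linear B" "\<And>x. x \<in> K' \<Longrightarrow> v x = B x + d"
      using v(1) K'(1) unfolding affine_on_elements_def by blast
    obtain D where D: "e = convex hull D" "\<And>z. z \<in> D \<Longrightarrow> z extreme_point_of K"
      using simplex_face_vertices [OF \<T>(3) [OF K(1)] K(2)] by metis
    have "A z + c = B z + d" if "z \<in> D" for z
    proof -
      have "z \<in> e" "z \<in> nodes \<T>"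
        using that D K(1) by (auto simp: hull_inc nodes_def)
      then show ?thesis
        using w(3) A(2) B(2) K'(2) face_of_imp_subset [OF K(2)] e(2) by (metis subsetD)
    qed
    then have "A x + c = B x + d"
      using affine_maps_agree_on_hull [OF A(1) B(1)] e(1) D(1) by blast
    then show ?thesis
      using A(2) B(2) e(1) K'(2) face_of_imp_subset [OF K(2)] by (metis subsetD)
  qed
  have boundary: "w x = 0" if x: "x \<in> frontier \<Omega> - \<Sigma>" for x
  proof -
    have "x \<in> \<Union>\<T>"
      using x \<T>(2) by (simp add: frontier_def)
    then obtain K where K: "K \<in> \<T>" "x \<in> K"
      by blast
    obtain F where F: "F face_of K" "x \<in> rel_interior F"
      using simplex_carrier_face [OF \<T>(3) [OF K(1)] K(2)] by blast
    have "rel_interior F \<subseteq> frontier \<Omega>"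
      using mesh_open_face_subset_frontier [OF dom mesh K(1) F] x by blast
    moreover have "rel_interior F \<inter> \<Sigma> = {}"
      using mesh_face_meeting_interface [OF \<T>(1) match(2) K(1) F(1)] F(2) rel_interior_subset [of F] x
      by blast
    ultimately have "closure (rel_interior F) \<subseteq> closure (frontier \<Omega> - \<Sigma>)"
      by (intro closure_mono) blast
    then have F_closure: "F \<subseteq> closure (frontier \<Omega> - \<Sigma>)"
      using convex_closure_rel_interior [OF face_of_imp_convex [OF F(1)]] closure_subset [of F]
      by blast
    obtain A c where A: "linear A" "\<And>x. x \<in> K \<Longrightarrow> w x = A x + c"
      using w(2) K(1) unfolding affine_on_elements_def by blast
    obtain D where D: "F = convex hull D" "\<And>z. z \<in> D \<Longrightarrow> z extreme_point_of K"
      using simplex_face_vertices [OF \<T>(3) [OF K(1)] F(1)] by metis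
    have "A z + c = 0 + 0" if z: "z \<in> D" for z
    proof -
      have "z \<in> F" "z \<in> nodes \<T>" "z \<in> K"
        using z D K(1) by (auto simp: hull_inc nodes_def extreme_point_of_def)
      moreover have "v z = 0" if "z \<in> \<Sigma>"
      proof -
        have "z \<in> closure (frontier \<Omega> - \<Sigma>) \<inter> \<Sigma>"
          using F_closure \<open>z \<in> F\<close> that by blast
        also have "\<dots> = {a, b}"
          using closure_frontier_minus_interface [OF dom _ seg(2)] seg(3) unfolding seg(1) by simp
        finally show ?thesis
          using v(2,3) by auto
      qed
      ultimately show ?thesis
        using w(3) A(2) by (metis add.right_neutral)
    qed
    then have "A x + c = 0 + 0"
      using affine_maps_agree_on_hull [OF A(1) linear_zero] D(1) F(2) rel_interior_subset [of F] by blast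
    then show ?thesis
      using A(2) K(2) by simp
  qed
  show thesis
  proof (rule that)
    show "w \<in> V_space \<Omega> \<Sigma> \<T>"
      using w(1,2) boundary \<T>(2) by (simp add: V_space_def)
  qed (use trace w(3) in auto)
qed

section \<open>Inner products and the work at the interface\<close>

lemma L2_commute: "L2 S f g = L2 S g f"
  by (simp add: L2_def inner_commute)

lemma L2_norm_power2: "(L2_norm S f)\<^sup>2 = L2 S f f"
proof -
  have "0 \<le> L2 S f f"
    unfolding L2_def set_lebesgue_integral_def by (intro Bochner_Integration.integral_nonneg) simp
  then show ?thesis
    by (simp add: L2_norm_def)
qed

lemma L2_seg_norm_power2: "(L2_seg_norm a b f)\<^sup>2 = L2_seg a b f f"
proof -
  have "0 \<le> L2_seg a b f f"
    unfolding L2_seg_def set_lebesgue_integral_def by (intro mult_nonneg_nonneg Bochner_Integration.integral_nonneg) simp_all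
  then show ?thesis
    by (simp add: L2_seg_norm_def)
qed

lemma L2_seg_commute: "L2_seg a b f g = L2_seg a b g f"
  by (simp add: L2_seg_def inner_commute)

lemma L2_seg_cong:
  assumes "\<And>x. x \<in> closed_segment a b \<Longrightarrow> f x = f' x" "\<And>x. x \<in> closed_segment a b \<Longrightarrow> g x = g' x"
  shows "L2_seg a b f g = L2_seg a b f' g'"
proof -
  have "linepath a b t \<in> closed_segment a b" if "t \<in> {0..1}" for t
    using that by (metis imageI linepath_image_01)
  then show ?thesis
    unfolding L2_seg_def using assms by (intro arg_cong2 [where f = "(*)"] refl set_lebesgue_integral_cong) auto
qed

lemma set_integrable_inner_linepath:
  assumes "continuous_on (closed_segment a b) f" "continuous_on (closed_segment a b) g"
  shows "set_integrable lebesgue {0..1} (\<lambda>t. f (linepath a b t) \<bullet> g (linepath a b t) :: real)"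
  by (intro absolutely_integrable_continuous_real continuous_on_inner
      continuous_on_compose2 [OF assms(1)] continuous_on_compose2 [OF assms(2)])
    (auto simp: linepath_image_01)

lemma L2_seg_diff_left:
  assumes "continuous_on (closed_segment a b) f" "continuous_on (closed_segment a b) g"
    "continuous_on (closed_segment a b) k"
  shows "L2_seg a b (\<lambda>x. f x - g x) k = L2_seg a b f k - L2_seg a b g k"
  unfolding L2_seg_def inner_diff_left
  by (simp add: set_integral_diff set_integrable_inner_linepath assms right_diff_distrib)

lemma L2_seg_diff_right:
  assumes "continuous_on (closed_segment a b) f" "continuous_on (closed_segment a b) g"
    "continuous_on (closed_segment a b) k"
  shows "L2_seg a b k (\<lambda>x. f x - g x) = L2_seg a b k f - L2_seg a b k g"
  using L2_seg_diff_left [OF assms] by (simp add: L2_seg_commute)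

text \<open>
  Here \<open>q\<close> is the solid velocity at the half step, and \<open>u\<^sub>0\<close>, \<open>u\<^sub>1\<close>, \<open>l\<^sub>0\<close>, \<open>l\<^sub>1\<close> are the fluid velocity and the
  interface stress before and after the step. The left-hand side is twice the work that the tested solid
  and fluid equations leave at the interface. Using the stress update \<open>l\<^sub>1 - l\<^sub>0 = - \<alpha> (u\<^sub>1 - q)\<close>, tested
  with the four functions themselves, the two stress terms become
  \<open>(|l\<^sub>1|\<^sup>2 - |l\<^sub>0|\<^sup>2) / \<alpha> - \<alpha> |u\<^sub>1 - q|\<^sup>2\<close>, and the subtracted square cancels against the Robin terms.
\<close>

lemma interface_work_identity:
  fixes q u\<^sub>0 u\<^sub>1 l\<^sub>0 l\<^sub>1 :: vec_field
  assumes cont: "\<And>f. f \<in> {q, u\<^sub>0, u\<^sub>1, l\<^sub>0, l\<^sub>1} \<Longrightarrow> continuous_on (closed_segment a b) f"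
    and "\<alpha> \<noteq> 0"
    and update: "\<And>m. m \<in> {q, u\<^sub>1, l\<^sub>0, l\<^sub>1} \<Longrightarrow>
      L2_seg a b l\<^sub>1 m = L2_seg a b l\<^sub>0 m - \<alpha> * L2_seg a b (\<lambda>x. u\<^sub>1 x - q x) m"
  shows "2 * (\<alpha> * L2_seg a b (\<lambda>x. q x - u\<^sub>0 x) q + L2_seg a b l\<^sub>0 q
        + \<alpha> * L2_seg a b (\<lambda>x. u\<^sub>1 x - q x) u\<^sub>1 - L2_seg a b l\<^sub>0 u\<^sub>1)
    = \<alpha> * L2_seg a b (\<lambda>x. q x - u\<^sub>0 x) (\<lambda>x. q x - u\<^sub>0 x)
      + \<alpha> * (L2_seg a b u\<^sub>1 u\<^sub>1 - L2_seg a b u\<^sub>0 u\<^sub>0)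
      + 1 / \<alpha> * (L2_seg a b l\<^sub>1 l\<^sub>1 - L2_seg a b l\<^sub>0 l\<^sub>0)"
proof -
  let ?b = "L2_seg a b"
  have diff: "?b (\<lambda>x. f x - g x) m = ?b f m - ?b g m" "?b m (\<lambda>x. f x - g x) = ?b m f - ?b m g"
    if "f \<in> {q, u\<^sub>0, u\<^sub>1, l\<^sub>0, l\<^sub>1}" "g \<in> {q, u\<^sub>0, u\<^sub>1, l\<^sub>0, l\<^sub>1}" "m \<in> {q, u\<^sub>0, u\<^sub>1, l\<^sub>0, l\<^sub>1}" for f g m
    using cont that by (simp_all add: L2_seg_diff_left L2_seg_diff_right)
  have upd: "?b l\<^sub>1 m = ?b l\<^sub>0 m - \<alpha> * (?b u\<^sub>1 m - ?b q m)" if "m \<in> {q, u\<^sub>1, l\<^sub>0, l\<^sub>1}" for m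
    using update [OF that] that diff(1) [of u\<^sub>1 q m] by auto
  have "continuous_on (closed_segment a b) (\<lambda>x. q x - u\<^sub>0 x)"
    using cont by (intro continuous_on_diff) auto
  then have square: "?b (\<lambda>x. q x - u\<^sub>0 x) (\<lambda>x. q x - u\<^sub>0 x) = ?b q q - 2 * ?b q u\<^sub>0 + ?b u\<^sub>0 u\<^sub>0"
    using cont by (simp add: L2_seg_diff_left diff(2) L2_seg_commute [of a b u\<^sub>0 q])
  have sym: "?b l\<^sub>0 l\<^sub>1 = ?b l\<^sub>1 l\<^sub>0" "?b u\<^sub>1 l\<^sub>1 = ?b l\<^sub>1 u\<^sub>1" "?b q l\<^sub>1 = ?b l\<^sub>1 q"
    "?b u\<^sub>1 l\<^sub>0 = ?b l\<^sub>0 u\<^sub>1" "?b q l\<^sub>0 = ?b l\<^sub>0 q" "?b q u\<^sub>1 = ?b u\<^sub>1 q" "?b u\<^sub>0 q = ?b q u\<^sub>0"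
    by (rule L2_seg_commute)+
  have "?b l\<^sub>1 l\<^sub>1 = ?b l\<^sub>0 l\<^sub>1 - \<alpha> * (?b u\<^sub>1 l\<^sub>1 - ?b q l\<^sub>1)"
    using upd by blast
  also have "\<dots> = ?b l\<^sub>1 l\<^sub>0 - \<alpha> * (?b l\<^sub>1 u\<^sub>1 - ?b l\<^sub>1 q)"
    by (simp only: sym(1-3))
  also have "\<dots> = (?b l\<^sub>0 l\<^sub>0 - \<alpha> * (?b u\<^sub>1 l\<^sub>0 - ?b q l\<^sub>0))
      - \<alpha> * ((?b l\<^sub>0 u\<^sub>1 - \<alpha> * (?b u\<^sub>1 u\<^sub>1 - ?b q u\<^sub>1)) - (?b l\<^sub>0 q - \<alpha> * (?b u\<^sub>1 q - ?b q q)))"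
    by (simp add: upd)
  finally have "?b l\<^sub>1 l\<^sub>1 - ?b l\<^sub>0 l\<^sub>0
      = \<alpha> * (2 * (?b l\<^sub>0 q - ?b l\<^sub>0 u\<^sub>1) + \<alpha> * (?b u\<^sub>1 u\<^sub>1 - 2 * ?b u\<^sub>1 q + ?b q q))"
    by (simp add: sym(4-6) algebra_simps)
  then have stress: "1 / \<alpha> * (?b l\<^sub>1 l\<^sub>1 - ?b l\<^sub>0 l\<^sub>0)
      = 2 * (?b l\<^sub>0 q - ?b l\<^sub>0 u\<^sub>1) + \<alpha> * (?b u\<^sub>1 u\<^sub>1 - 2 * ?b u\<^sub>1 q + ?b q q)"
    using \<open>\<alpha> \<noteq> 0\<close> by simp
  have work: "?b (\<lambda>x. q x - u\<^sub>0 x) q = ?b q q - ?b q u\<^sub>0" "?b (\<lambda>x. u\<^sub>1 x - q x) u\<^sub>1 = ?b u\<^sub>1 u\<^sub>1 - ?b u\<^sub>1 q"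
    by (simp_all add: diff sym(6,7))
  show ?thesis
    unfolding square stress work by (simp add: algebra_simps)
qed

lemma set_integrable_inner_continuous:
  fixes f g :: "real^2 \<Rightarrow> 'b::euclidean_space"
  assumes "bounded S" "open S" "continuous_on (closure S) f" "continuous_on (closure S) g"
  shows "set_integrable lebesgue S (\<lambda>x. f x \<bullet> g x)"
proof -
  have "compact (closure S)"
    using assms(1) by simp
  then have "set_integrable lborel (closure S) (\<lambda>x. f x \<bullet> g x)"
    unfolding set_integrable_def by (intro borel_integrable_compact continuous_on_inner assms)
  then have "set_integrable lebesgue (closure S) (\<lambda>x. f x \<bullet> g x)"
    unfolding set_integrable_def using integrable_completion by blast
  then show ?thesis
    by (rule set_integrable_subset) (use assms(2) closure_subset in auto)
qed

text \<open>
  The product of the average with the difference quotient is a difference of squares. The exceptional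
  null set \<open>N\<close> makes the lemma applicable to gradients, which are prescribed only off the mesh skeleton.
\<close>

lemma L2_average_increment:
  assumes int: "set_integrable lebesgue S (\<lambda>x. f\<^sub>0 x \<bullet> f\<^sub>0 x)" "set_integrable lebesgue S (\<lambda>x. f\<^sub>1 x \<bullet> f\<^sub>1 x)"
    and N: "negligible N"
    and A: "\<And>x. x \<in> S - N \<Longrightarrow> A x = (1 / 2) *\<^sub>R (f\<^sub>1 x + f\<^sub>0 x)"
    and D: "\<And>x. x \<in> S - N \<Longrightarrow> D x = (1 / dt) *\<^sub>R (f\<^sub>1 x - f\<^sub>0 x)"
  shows "L2 S A D = 1 / (2 * dt) * (L2 S f\<^sub>1 f\<^sub>1 - L2 S f\<^sub>0 f\<^sub>0)"
proof -
  let ?g = "\<lambda>x. 1 / (2 * dt) * (f\<^sub>1 x \<bullet> f\<^sub>1 x - f\<^sub>0 x \<bullet> f\<^sub>0 x)"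
  have eq: "A x \<bullet> D x = ?g x" if "x \<in> S - N" for x
    unfolding A [OF that] D [OF that]
    by (cases "dt = 0")
      (simp_all add: inner_add_left inner_diff_right inner_commute [of "f\<^sub>1 x" "f\<^sub>0 x"] field_simps)
  have g: "set_integrable lebesgue S ?g"
    by (intro set_integrable_mult_right set_integral_diff int)
  then have AD: "set_integrable lebesgue S (\<lambda>x. A x \<bullet> D x)"
    by (rule absolutely_integrable_spike [OF _ N]) (rule eq)
  have "L2 S A D = integral S (\<lambda>x. A x \<bullet> D x)"
    unfolding L2_def by (rule set_lebesgue_integral_eq_integral [OF AD])
  also have "\<dots> = integral S ?g"
    by (rule integral_spike [OF N]) (simp add: eq)
  also have "\<dots> = (LINT x:S|lebesgue. ?g x)"
    by (rule set_lebesgue_integral_eq_integral(2) [OF g, symmetric])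
  also have "\<dots> = 1 / (2 * dt) * (L2 S f\<^sub>1 f\<^sub>1 - L2 S f\<^sub>0 f\<^sub>0)"
    unfolding L2_def set_integral_mult_right set_integral_diff(2) [OF int(2,1)] ..
  finally show ?thesis .
qed

text \<open>
  Testing with the final value instead of the average leaves the additional square of the increment:
  this is the numerical dissipation of the backward Euler step.
\<close>

lemma L2_increment_final:
  fixes f\<^sub>0 f\<^sub>1 :: "real^2 \<Rightarrow> 'b::euclidean_space"
  assumes S: "bounded S" "open S" and cont: "continuous_on (closure S) f\<^sub>0" "continuous_on (closure S) f\<^sub>1"
  shows "L2 S (\<lambda>x. (1 / dt) *\<^sub>R (f\<^sub>1 x - f\<^sub>0 x)) f\<^sub>1
    = 1 / (2 * dt) * (L2 S f\<^sub>1 f\<^sub>1 - L2 S f\<^sub>0 f\<^sub>0 + L2 S (\<lambda>x. f\<^sub>1 x - f\<^sub>0 x) (\<lambda>x. f\<^sub>1 x - f\<^sub>0 x))"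
proof -
  have int: "set_integrable lebesgue S (\<lambda>x. f\<^sub>1 x \<bullet> f\<^sub>1 x)" "set_integrable lebesgue S (\<lambda>x. f\<^sub>0 x \<bullet> f\<^sub>0 x)"
      "set_integrable lebesgue S (\<lambda>x. (f\<^sub>1 x - f\<^sub>0 x) \<bullet> (f\<^sub>1 x - f\<^sub>0 x))"
    by (intro set_integrable_inner_continuous [OF S] cont continuous_on_diff)+
  have "L2 S (\<lambda>x. (1 / dt) *\<^sub>R (f\<^sub>1 x - f\<^sub>0 x)) f\<^sub>1 =
    (LINT x:S|lebesgue. 1 / (2 * dt) *
      (f\<^sub>1 x \<bullet> f\<^sub>1 x - f\<^sub>0 x \<bullet> f\<^sub>0 x + (f\<^sub>1 x - f\<^sub>0 x) \<bullet> (f\<^sub>1 x - f\<^sub>0 x)))"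
    unfolding L2_def
    by (rule arg_cong [where f = "set_lebesgue_integral lebesgue S"])
      (cases "dt = 0"; auto simp: fun_eq_iff inner_diff_left inner_diff_right inner_commute field_simps)
  also have "\<dots> = 1 / (2 * dt) *
      (L2 S f\<^sub>1 f\<^sub>1 - L2 S f\<^sub>0 f\<^sub>0 + L2 S (\<lambda>x. f\<^sub>1 x - f\<^sub>0 x) (\<lambda>x. f\<^sub>1 x - f\<^sub>0 x))"
    unfolding L2_def set_integral_mult_right
      set_integral_add(2) [OF set_integral_diff(1) [OF int(1,2)] int(3)]
      set_integral_diff(2) [OF int(1,2)] ..
  finally show ?thesis .
qed

section \<open>Gradients of piecewise affine functions\<close>

lemma jacobian_linear_combination:
  fixes f g :: vec_field
  assumes "f differentiable (at x)" "g differentiable (at x)"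
  shows "jacobian (\<lambda>x. r *\<^sub>R f x + s *\<^sub>R g x) (at x) = r *\<^sub>R jacobian f (at x) + s *\<^sub>R jacobian g (at x)"
proof -
  have "((\<lambda>x. r *\<^sub>R f x + s *\<^sub>R g x) has_derivative
      (\<lambda>h. r *\<^sub>R frechet_derivative f (at x) h + s *\<^sub>R frechet_derivative g (at x) h)) (at x)"
    using assms by (intro derivative_intros) (simp_all add: frechet_derivative_works)
  then have "frechet_derivative (\<lambda>x. r *\<^sub>R f x + s *\<^sub>R g x) (at x) =
      (\<lambda>h. r *\<^sub>R frechet_derivative f (at x) h + s *\<^sub>R frechet_derivative g (at x) h)"
    by (rule frechet_derivative_at [symmetric])
  then show ?thesis
    by (simp add: jacobian_def matrix_def vec_eq_iff)
qed

lemma sym_grad_linear_combination: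
  assumes "f differentiable (at x)" "g differentiable (at x)"
  shows "sym_grad (\<lambda>x. r *\<^sub>R f x + s *\<^sub>R g x) x = r *\<^sub>R sym_grad f x + s *\<^sub>R sym_grad g x"
  unfolding sym_grad_def jacobian_linear_combination [OF assms]
  by (simp add: vec_eq_iff transpose_def algebra_simps)

lemma divg_linear_combination:
  assumes "f differentiable (at x)" "g differentiable (at x)"
  shows "divg (\<lambda>x. r *\<^sub>R f x + s *\<^sub>R g x) x = r *\<^sub>R divg f x + s *\<^sub>R divg g x"
  unfolding divg_def jacobian_linear_combination [OF assms]
  by (simp add: trace_def sum.distrib sum_distrib_left)

lemma jacobian_cong_open:
  assumes "f differentiable (at x)" "open S" "x \<in> S" "\<And>y. y \<in> S \<Longrightarrow> f y = g y"
  shows "jacobian f (at x) = jacobian g (at x)"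
  unfolding jacobian_def using frechet_derivative_transform_within_open [OF assms] by simp

lemma affine_on_elements_has_derivative:
  fixes v :: "real^2 \<Rightarrow> 'b::real_normed_vector"
  assumes "affine_on_elements \<T> v" "K \<in> \<T>"
  obtains A where "\<And>x. x \<in> interior K \<Longrightarrow> (v has_derivative A) (at x)"
proof -
  obtain A c where A: "linear A" "\<And>x. x \<in> K \<Longrightarrow> v x = A x + c"
    using assms unfolding affine_on_elements_def by blast
  have "(v has_derivative A) (at x)" if "x \<in> interior K" for x
  proof (rule has_derivative_transform_within_open)
    have "(A has_derivative A) (at x)"
      using A(1) by (simp add: linear_conv_bounded_linear bounded_linear_imp_has_derivative)
    then show "((\<lambda>x. A x + c) has_derivative A) (at x)"
      by (auto intro: derivative_eq_intros)
    show "A y + c = v y" if "y \<in> interior K" for y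
      using A(2) interior_subset that by force
  qed (use that in auto)
  then show thesis
    by (rule that)
qed

lemma simplicial_mesh_skeleton:
  assumes "simplicial_mesh \<Omega> \<T>"
  shows "negligible (\<Union>K\<in>\<T>. frontier K)" "\<Omega> - (\<Union>K\<in>\<T>. frontier K) \<subseteq> (\<Union>K\<in>\<T>. interior K)"
proof -
  have \<T>: "finite \<T>" "\<Union>\<T> = closure \<Omega>" "\<And>K. K \<in> \<T> \<Longrightarrow> 2 simplex K"
    using assms by (auto simp: simplicial_mesh_def triangulation_def)
  show "negligible (\<Union>K\<in>\<T>. frontier K)"
    using \<T>(1) negligible_convex_frontier [OF convex_simplex [OF \<T>(3)]] by (intro negligible_Union) auto
  show "\<Omega> - (\<Union>K\<in>\<T>. frontier K) \<subseteq> (\<Union>K\<in>\<T>. interior K)"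
  proof
    fix x assume x: "x \<in> \<Omega> - (\<Union>K\<in>\<T>. frontier K)"
    then have "x \<in> \<Union>\<T>"
      using closure_subset \<T>(2) by auto
    then obtain K where K: "K \<in> \<T>" "x \<in> K"
      by (rule UnionE)
    have "x \<notin> frontier K"
      using x K(1) by simp
    then have "x \<in> interior K"
      using K(2) closure_subset [of K] by (auto simp: frontier_def)
    then show "x \<in> (\<Union>K\<in>\<T>. interior K)"
      using K(1) by blast
  qed
qed

text \<open>
  The values on the mesh skeleton are arbitrary, as are those of the classical gradient of a piecewise
  affine function; the skeleton is a null set, and Lebesgue measure is complete.
\<close>

lemma set_integrable_piecewise_constant:
  fixes f :: "real^2 \<Rightarrow> real"
  assumes "simplicial_mesh \<Omega> \<T>" "bounded \<Omega>" "open \<Omega>"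
    and const: "\<And>K. K \<in> \<T> \<Longrightarrow> f constant_on (interior K)"
  shows "set_integrable lebesgue \<Omega> f"
proof -
  have \<T>: "finite \<T>" "\<Union>\<T> = closure \<Omega>" "\<And>K. K \<in> \<T> \<Longrightarrow> 2 simplex K"
    using assms(1) by (auto simp: simplicial_mesh_def triangulation_def)
  have sets: "\<Omega> \<inter> K \<in> sets lebesgue" if "K \<in> \<T>" for K
    using closed_simplex [OF \<T>(3) [OF that]] assms(3) by (intro sets.Int) auto
  have "set_integrable lebesgue (\<Omega> \<inter> K) f" if K: "K \<in> \<T>" for K
  proof -
    obtain c where c: "\<And>x. x \<in> interior K \<Longrightarrow> f x = c"
      using const [OF K] unfolding constant_on_def by blast
    have "\<Omega> \<inter> K \<in> lmeasurable"
      using bounded_subset [OF assms(2)] sets [OF K] by (intro bounded_set_imp_lmeasurable) auto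
    then have "set_integrable lebesgue (\<Omega> \<inter> K) (\<lambda>x. c)"
      by (rule absolutely_integrable_on_const)
    moreover have "negligible (frontier K)"
      using convex_simplex [OF \<T>(3) [OF K]] negligible_convex_frontier by blast
    moreover have "f x = c" if "x \<in> \<Omega> \<inter> K - frontier K" for x
      using that c closure_subset [of K] by (auto simp: frontier_def)
    ultimately show ?thesis
      by (rule absolutely_integrable_spike)
  qed
  then have "set_integrable lebesgue (\<Union>K\<in>\<T>. \<Omega> \<inter> K) f"
    by (intro set_integrable_UN \<T>(1) sets)
  moreover have "(\<Union>K\<in>\<T>. \<Omega> \<inter> K) = \<Omega> \<inter> \<Union>\<T>"
    by blast
  moreover have "\<Omega> \<inter> \<Union>\<T> = \<Omega>"
    unfolding \<T>(2) using closure_subset by (rule Int_absorb2)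
  ultimately show ?thesis
    by simp
qed

text \<open>
  Tested with the difference quotient of the displacement, the elastic form at the averaged displacement
  is the difference quotient of the elastic energy: off the mesh skeleton both gradient products are
  differences of squares.
\<close>

lemma a_solid_average_increment:
  assumes mesh: "simplicial_mesh \<Omega> \<T>" and dom: "bounded \<Omega>" "open \<Omega>"
    and aff: "affine_on_elements \<T> (\<eta> n)" "affine_on_elements \<T> (\<eta> (n + 1))"
    and \<xi>: "\<And>x. x \<in> \<Omega> \<Longrightarrow> \<xi> x = ddt dt \<eta> (n + 1) x"
  shows "a_solid L\<^sub>1 L\<^sub>2 \<Omega> (mid \<eta> n) \<xi> =
    1 / (2 * dt) * (a_solid L\<^sub>1 L\<^sub>2 \<Omega> (\<eta> (n + 1)) (\<eta> (n + 1)) - a_solid L\<^sub>1 L\<^sub>2 \<Omega> (\<eta> n) (\<eta> n))"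
proof -
  let ?N = "\<Union>K\<in>\<T>. frontier K"
  have mid: "mid \<eta> n = (\<lambda>x. (1 / 2) *\<^sub>R \<eta> (n + 1) x + (1 / 2) *\<^sub>R \<eta> n x)"
    and ddt: "ddt dt \<eta> (n + 1) = (\<lambda>x. (1 / dt) *\<^sub>R \<eta> (n + 1) x + (- (1 / dt)) *\<^sub>R \<eta> n x)"
    by (simp_all add: mid_def ddt_def algebra_simps)
  have diff: "\<eta> n differentiable (at x)" "\<eta> (n + 1) differentiable (at x)" if x: "x \<in> \<Omega> - ?N" for x
  proof -
    obtain K where K: "K \<in> \<T>" "x \<in> interior K"
      using simplicial_mesh_skeleton(2) [OF mesh] x by blast
    obtain A B where "(\<eta> n has_derivative A) (at x)" "(\<eta> (n + 1) has_derivative B) (at x)"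
      using affine_on_elements_has_derivative [OF aff(1) K(1)]
        affine_on_elements_has_derivative [OF aff(2) K(1)] K(2) by metis
    then show "\<eta> n differentiable (at x)" "\<eta> (n + 1) differentiable (at x)"
      unfolding differentiable_def by blast+
  qed
  have jacobian: "jacobian \<xi> (at x) = jacobian (ddt dt \<eta> (n + 1)) (at x)" if x: "x \<in> \<Omega> - ?N" for x
  proof (rule jacobian_cong_open [symmetric, OF _ dom(2)])
    show "ddt dt \<eta> (n + 1) differentiable (at x)"
      unfolding ddt using diff [OF x] by (intro derivative_intros)
  qed (use x \<xi> in auto)
  have const: "\<exists>J. \<forall>x\<in>interior K. jacobian v (at x) = J"
    if v: "affine_on_elements \<T> v" "K \<in> \<T>" for v :: vec_field and K
  proof -
    obtain A where "\<And>x. x \<in> interior K \<Longrightarrow> (v has_derivative A) (at x)"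
      using affine_on_elements_has_derivative [OF v] by blast
    then have "jacobian v (at x) = matrix A" if "x \<in> interior K" for x
      using frechet_derivative_at [of v A x] that by (simp add: jacobian_def)
    then show ?thesis
      by blast
  qed
  have int: "set_integrable lebesgue \<Omega> (\<lambda>x. sym_grad v x \<bullet> sym_grad v x)"
    "set_integrable lebesgue \<Omega> (\<lambda>x. divg v x \<bullet> divg v x)" if v: "affine_on_elements \<T> v" for v
  proof -
    have const_on: "(\<lambda>x. F (jacobian v (at x))) constant_on (interior K)" if K: "K \<in> \<T>" for F :: "real^2^2 \<Rightarrow> real" and K
    proof -
      obtain J where "\<forall>x\<in>interior K. jacobian v (at x) = J"
        using const [OF v K] by blast
      then have "\<forall>x\<in>interior K. F (jacobian v (at x)) = F J"
        by simp
      then show ?thesis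
        unfolding constant_on_def by blast
    qed
    show "set_integrable lebesgue \<Omega> (\<lambda>x. sym_grad v x \<bullet> sym_grad v x)"
      unfolding sym_grad_def
      by (rule set_integrable_piecewise_constant [OF mesh dom])
        (rule const_on [of _ "\<lambda>J. ((1/2) *\<^sub>R (J + transpose J)) \<bullet> ((1/2) *\<^sub>R (J + transpose J))"])
    show "set_integrable lebesgue \<Omega> (\<lambda>x. divg v x \<bullet> divg v x)"
      unfolding divg_def
      by (rule set_integrable_piecewise_constant [OF mesh dom])
        (rule const_on [of _ "\<lambda>J. trace J \<bullet> trace J"])
  qed
  have "L2 \<Omega> (sym_grad (mid \<eta> n)) (sym_grad \<xi>) =
      1 / (2 * dt) * (L2 \<Omega> (sym_grad (\<eta> (n + 1))) (sym_grad (\<eta> (n + 1)))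
        - L2 \<Omega> (sym_grad (\<eta> n)) (sym_grad (\<eta> n)))"
  proof (rule L2_average_increment [OF int(1) [OF aff(1)] int(1) [OF aff(2)] simplicial_mesh_skeleton(1) [OF mesh]])
    fix x assume x: "x \<in> \<Omega> - ?N"
    show "sym_grad (mid \<eta> n) x = (1 / 2) *\<^sub>R (sym_grad (\<eta> (n + 1)) x + sym_grad (\<eta> n) x)"
      unfolding mid sym_grad_linear_combination [OF diff(2) [OF x] diff(1) [OF x]] by (simp only: scaleR_add_right)
    have "sym_grad \<xi> x = sym_grad (ddt dt \<eta> (n + 1)) x"
      by (simp add: sym_grad_def jacobian [OF x])
    then show "sym_grad \<xi> x = (1 / dt) *\<^sub>R (sym_grad (\<eta> (n + 1)) x - sym_grad (\<eta> n) x)"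
      unfolding ddt sym_grad_linear_combination [OF diff(2) [OF x] diff(1) [OF x]] by (simp add: algebra_simps)
  qed
  moreover have "L2 \<Omega> (divg (mid \<eta> n)) (divg \<xi>) =
      1 / (2 * dt) * (L2 \<Omega> (divg (\<eta> (n + 1))) (divg (\<eta> (n + 1))) - L2 \<Omega> (divg (\<eta> n)) (divg (\<eta> n)))"
  proof (rule L2_average_increment [OF int(2) [OF aff(1)] int(2) [OF aff(2)] simplicial_mesh_skeleton(1) [OF mesh]])
    fix x assume x: "x \<in> \<Omega> - ?N"
    show "divg (mid \<eta> n) x = (1 / 2) *\<^sub>R (divg (\<eta> (n + 1)) x + divg (\<eta> n) x)"
      unfolding mid divg_linear_combination [OF diff(2) [OF x] diff(1) [OF x]] by (simp only: scaleR_add_right)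
    have "divg \<xi> x = divg (ddt dt \<eta> (n + 1)) x"
      by (simp add: divg_def jacobian [OF x])
    then show "divg \<xi> x = (1 / dt) *\<^sub>R (divg (\<eta> (n + 1)) x - divg (\<eta> n) x)"
      unfolding ddt divg_linear_combination [OF diff(2) [OF x] diff(1) [OF x]] by (simp add: algebra_simps)
  qed
  ultimately show ?thesis
    unfolding a_solid_def by (simp only:) (simp add: algebra_simps)
qed

lemma V_space_linear_combination:
  assumes "v \<in> V_space \<Omega> \<Sigma> \<T>" "w \<in> V_space \<Omega> \<Sigma> \<T>"
  shows "(\<lambda>x. r *\<^sub>R v x + s *\<^sub>R w x) \<in> V_space \<Omega> \<Sigma> \<T>"
proof -
  have "\<exists>A c. linear A \<and> (\<forall>x\<in>K. r *\<^sub>R v x + s *\<^sub>R w x = A x + c)" if "K \<in> \<T>" for K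
  proof -
    have "affine_on_elements \<T> v" "affine_on_elements \<T> w"
      using assms by (simp_all add: V_space_def)
    then have "\<exists>A c. linear A \<and> (\<forall>x\<in>K. v x = A x + c)" "\<exists>B d. linear B \<and> (\<forall>x\<in>K. w x = B x + d)"
      using that unfolding affine_on_elements_def by auto
    then obtain A c B d where A: "linear A" "\<forall>x\<in>K. v x = A x + c" and B: "linear B" "\<forall>x\<in>K. w x = B x + d"
      by (elim exE conjE)
    have "linear (\<lambda>x. r *\<^sub>R A x + s *\<^sub>R B x)"
      by (intro linear_compose_add linear_compose_scale_right A B)
    moreover have "\<forall>x\<in>K. r *\<^sub>R v x + s *\<^sub>R w x = (r *\<^sub>R A x + s *\<^sub>R B x) + (r *\<^sub>R c + s *\<^sub>R d)"
      using A(2) B(2) by (simp add: scaleR_add_right)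
    ultimately show ?thesis
      by blast
  qed
  moreover have "continuous_on (closure \<Omega>) (\<lambda>x. r *\<^sub>R v x + s *\<^sub>R w x)"
    using assms by (intro continuous_intros) (auto simp: V_space_def)
  ultimately show ?thesis
    using assms by (simp add: V_space_def affine_on_elements_def)
qed

section \<open>The energy identity\<close>

theorem lemma3p1:
  fixes \<Omega>\<^sub>s \<Omega>\<^sub>f \<Sigma> :: "(real^2) set"
    and a b :: "real^2"
    and \<T>\<^sub>s \<T>\<^sub>f :: "(real^2) set set"
    and \<kappa> h \<rho>\<^sub>s \<rho>\<^sub>f \<mu> L\<^sub>1 L\<^sub>2 \<alpha> dt :: real
    and N M :: nat
    and V\<^sub>s V\<^sub>f V\<^sub>g :: "vec_field set"
    and M\<^sub>f :: "(real^2 \<Rightarrow> real) set"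
    and q \<eta> u \<Lambda> :: "nat \<Rightarrow> vec_field"
    and p :: "nat \<Rightarrow> real^2 \<Rightarrow> real"
    and S Z :: "nat \<Rightarrow> real"
  assumes domains: "polygonal_domain \<Omega>\<^sub>s" "polygonal_domain \<Omega>\<^sub>f" "\<Omega>\<^sub>s \<inter> \<Omega>\<^sub>f = {}"
    and interface: "\<Sigma> = frontier \<Omega>\<^sub>s \<inter> frontier \<Omega>\<^sub>f" "\<Sigma> = closed_segment a b" "a \<noteq> b"
    and meshes: "simplicial_mesh \<Omega>\<^sub>s \<T>\<^sub>s" "simplicial_mesh \<Omega>\<^sub>f \<T>\<^sub>f"
      "shape_regular \<kappa> \<T>\<^sub>s" "shape_regular \<kappa> \<T>\<^sub>f"
      "quasi_uniform \<kappa> h \<T>\<^sub>s" "quasi_uniform \<kappa> h \<T>\<^sub>f"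
      "meshes_match \<Sigma> \<T>\<^sub>s \<T>\<^sub>f"
    and params: "\<rho>\<^sub>s > 0" "\<rho>\<^sub>f > 0" "\<mu> > 0" "L\<^sub>1 > 0" "L\<^sub>2 \<ge> 0" "\<alpha> > 0" "dt > 0"
    and spaces: "V\<^sub>s = V_space \<Omega>\<^sub>s \<Sigma> \<T>\<^sub>s" "V\<^sub>f = V_space \<Omega>\<^sub>f \<Sigma> \<T>\<^sub>f"
      "M\<^sub>f = M_space \<Omega>\<^sub>f \<T>\<^sub>f" "V\<^sub>g = trace_space \<Sigma> V\<^sub>f"
    and initial: "q 0 \<in> V\<^sub>s" "\<eta> 0 \<in> V\<^sub>s" "u 0 \<in> V\<^sub>f" "\<Lambda> 0 \<in> V\<^sub>g"
    and solid_spaces: "\<And>n. n < N \<Longrightarrow> q (n + 1) \<in> V\<^sub>s" "\<And>n. n < N \<Longrightarrow> \<eta> (n + 1) \<in> V\<^sub>s"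
    and solid_kinematic: "\<And>n x. n < N \<Longrightarrow> x \<in> closure \<Omega>\<^sub>s \<Longrightarrow> mid q n x = ddt dt \<eta> (n + 1) x"
    and solid_dynamic: "\<And>n \<xi>. n < N \<Longrightarrow> \<xi> \<in> V\<^sub>s \<Longrightarrow>
        \<rho>\<^sub>s * L2 \<Omega>\<^sub>s (ddt dt q (n + 1)) \<xi> + a_solid L\<^sub>1 L\<^sub>2 \<Omega>\<^sub>s (mid \<eta> n) \<xi>
          + \<alpha> * L2_seg a b (\<lambda>x. mid q n x - u n x) \<xi> + L2_seg a b (\<Lambda> n) \<xi> = 0"
    and fluid_spaces: "\<And>n. n < N \<Longrightarrow> u (n + 1) \<in> V\<^sub>f" "\<And>n. n < N \<Longrightarrow> p (n + 1) \<in> M\<^sub>f"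
    and fluid: "\<And>n v \<theta>. n < N \<Longrightarrow> v \<in> V\<^sub>f \<Longrightarrow> \<theta> \<in> M\<^sub>f \<Longrightarrow>
        \<rho>\<^sub>f * L2 \<Omega>\<^sub>f (ddt dt u (n + 1)) v + a_fluid \<mu> h \<Omega>\<^sub>f (u (n + 1), p (n + 1)) (v, \<theta>)
          + \<alpha> * L2_seg a b (\<lambda>x. u (n + 1) x - mid q n x) v - L2_seg a b (\<Lambda> n) v = 0"
    and stress_spaces: "\<And>n. n < N \<Longrightarrow> \<Lambda> (n + 1) \<in> V\<^sub>g"
    and stress: "\<And>n m. n < N \<Longrightarrow> m \<in> V\<^sub>g \<Longrightarrow>
        L2_seg a b (\<Lambda> (n + 1)) m =
          \<rho>\<^sub>f * L2 \<Omega>\<^sub>f (ddt dt u (n + 1)) (lifting \<Omega>\<^sub>f \<Sigma> \<T>\<^sub>f m)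
          + a_fluid \<mu> h \<Omega>\<^sub>f (u (n + 1), p (n + 1)) (lifting \<Omega>\<^sub>f \<Sigma> \<T>\<^sub>f m, \<lambda>x. 0)"
    and S: "\<And>n. S n = a_solid L\<^sub>1 L\<^sub>2 \<Omega>\<^sub>s (\<eta> n) (\<eta> n) + \<rho>\<^sub>s * (L2_norm \<Omega>\<^sub>s (q n))\<^sup>2
        + \<rho>\<^sub>f * (L2_norm \<Omega>\<^sub>f (u n))\<^sup>2
        + dt * (\<alpha> * (L2_seg_norm a b (u n))\<^sup>2 + 1 / \<alpha> * (L2_seg_norm a b (\<Lambda> n))\<^sup>2)"
    and Z: "\<And>n. n \<ge> 1 \<Longrightarrow> Z n = \<rho>\<^sub>f * (L2_norm \<Omega>\<^sub>f (\<lambda>x. u n x - u (n - 1) x))\<^sup>2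
        + \<alpha> * dt * (L2_seg_norm a b (\<lambda>x. ddt dt \<eta> n x - u (n - 1) x))\<^sup>2
        + 4 * \<mu> * dt * (L2_norm \<Omega>\<^sub>f (sym_grad (u n)))\<^sup>2
        + 2 * h\<^sup>2 * dt * (L2_norm \<Omega>\<^sub>f (grad (p n)))\<^sup>2"
    and M: "1 \<le> M" "M \<le> N"
  shows "S M + (\<Sum>m = 1..M. Z m) = S 0"
proof -
  have \<Omega>s: "bounded \<Omega>\<^sub>s" "open \<Omega>\<^sub>s" and \<Omega>f: "bounded \<Omega>\<^sub>f" "open \<Omega>\<^sub>f"
    using domains(1,2) by (auto simp: polygonal_domain_def)
  have seg: "closed_segment a b \<subseteq> frontier \<Omega>\<^sub>s" "closed_segment a b \<subseteq> frontier \<Omega>\<^sub>f"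
    using interface(1,2) by auto
  then have seg_closure: "closed_segment a b \<subseteq> closure \<Omega>\<^sub>s" "closed_segment a b \<subseteq> closure \<Omega>\<^sub>f"
    by (auto simp: frontier_def)
  have match: "edges_on \<Sigma> \<T>\<^sub>f = edges_on \<Sigma> \<T>\<^sub>s" "\<Union>(edges_on \<Sigma> \<T>\<^sub>f) = \<Sigma>"
    using meshes(7) by (auto simp: meshes_match_def)
  have cont_s: "continuous_on (closure \<Omega>\<^sub>s) v" "affine_on_elements \<T>\<^sub>s v" if "v \<in> V\<^sub>s" for v
    using that spaces(1) by (auto simp: V_space_def)
  have cont_f: "continuous_on (closure \<Omega>\<^sub>f) v" "affine_on_elements \<T>\<^sub>f v" if "v \<in> V\<^sub>f" for v
    using that spaces(2) by (auto simp: V_space_def)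

  \<comment> \<open>The stress update may be tested with solid velocities only because their traces are traces of
    fluid functions.\<close>
  have solid_trace: "v \<in> V\<^sub>g" if v: "v \<in> V\<^sub>s" for v
  proof -
    have "v a = 0" "v b = 0"
      using V_space_vanishes_at_endpoints [OF domains(1) seg(1) interface(3)] v spaces(1) interface(2)
      by blast+
    then obtain w where "w \<in> V\<^sub>f" "\<And>x. x \<in> \<Sigma> \<Longrightarrow> w x = v x"
      using extension_by_zero_nodal_values [OF domains(2) meshes(2) interface(2,3) _ match cont_s(2) [OF v]]
        seg(2) interface(2) spaces(2) by metis
    then show ?thesis
      unfolding spaces(4) trace_space_def by (intro CollectI bexI [of _ w]) simp_all
  qed
  have fluid_trace: "v \<in> V\<^sub>g" if "v \<in> V\<^sub>f" for v
    using that unfolding spaces(4) trace_space_def by blast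
  \<comment> \<open>The lifting is defined by a choice, so its properties depend on the existence of some extension.\<close>
  have lifting: "lifting \<Omega>\<^sub>f \<Sigma> \<T>\<^sub>f m \<in> V\<^sub>f" "\<And>x. x \<in> closed_segment a b \<Longrightarrow> lifting \<Omega>\<^sub>f \<Sigma> \<T>\<^sub>f m x = m x"
    if m: "m \<in> V\<^sub>g" for m
  proof -
    obtain v where v: "v \<in> V\<^sub>f" "\<And>x. x \<in> \<Sigma> \<Longrightarrow> m x = v x"
      using m unfolding spaces(4) trace_space_def by blast
    have "v a = 0" "v b = 0"
      using V_space_vanishes_at_endpoints [OF domains(2) seg(2) interface(3)] v(1) spaces(2) interface(2)
      by blast+
    then obtain w where "w \<in> V\<^sub>f" "\<And>x. x \<in> \<Sigma> \<Longrightarrow> w x = v x" "\<And>z. z \<in> nodes \<T>\<^sub>f - \<Sigma> \<Longrightarrow> w z = 0"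
      using extension_by_zero_nodal_values [OF domains(2) meshes(2) interface(2,3) _ refl match(2) cont_f(2) [OF v(1)]]
        seg(2) interface(2) spaces(2) by metis
    then have "\<exists>w. w \<in> V_space \<Omega>\<^sub>f \<Sigma> \<T>\<^sub>f \<and> (\<forall>x\<in>\<Sigma>. w x = m x) \<and> (\<forall>z\<in>nodes \<T>\<^sub>f - \<Sigma>. w z = 0)"
      using v(2) spaces(2) by (intro exI [of _ w]) simp
    note someI_ex [OF this, folded lifting_def]
    then show "lifting \<Omega>\<^sub>f \<Sigma> \<T>\<^sub>f m \<in> V\<^sub>f" "\<And>x. x \<in> closed_segment a b \<Longrightarrow> lifting \<Omega>\<^sub>f \<Sigma> \<T>\<^sub>f m x = m x"
      using spaces(2) interface(2) by auto
  qed
  have cont_g: "continuous_on (closed_segment a b) m" if m: "m \<in> V\<^sub>g" for m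
  proof -
    have "continuous_on (closed_segment a b) (lifting \<Omega>\<^sub>f \<Sigma> \<T>\<^sub>f m)"
      using cont_f(1) [OF lifting(1) [OF m]] seg_closure(2) by (rule continuous_on_subset)
    then show ?thesis
      by (rule continuous_on_eq) (rule lifting(2) [OF m])
  qed
  have in_spaces: "q n \<in> V\<^sub>s" "\<eta> n \<in> V\<^sub>s" "u n \<in> V\<^sub>f" "\<Lambda> n \<in> V\<^sub>g" if "n \<le> N" for n
    using that initial solid_spaces fluid_spaces(1) stress_spaces
    by (cases n; simp)+

  have step: "S (n + 1) + Z (n + 1) = S n" if n: "n < N" for n
  proof -
    have le: "n \<le> N" "n + 1 \<le> N"
      using n by auto
    let ?b = "L2_seg a b" and ?q = "mid q n"
    have q: "?q \<in> V\<^sub>s"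
      using V_space_linear_combination [of "q (n + 1)" \<Omega>\<^sub>s \<Sigma> \<T>\<^sub>s "q n" "1/2" "1/2"] in_spaces(1) le spaces(1)
      by (simp add: mid_def scaleR_add_right)
    have cont: "continuous_on (closed_segment a b) f" if "f \<in> {?q, u n, u (n + 1), \<Lambda> n, \<Lambda> (n + 1)}" for f
      using that cont_g in_spaces(3,4) le solid_trace [OF q] fluid_trace by blast
    \<comment> \<open>The fluid equation tested with a lifting and zero pressure contains precisely the functional that
      defines the new stress.\<close>
    have update: "?b (\<Lambda> (n + 1)) m = ?b (\<Lambda> n) m - \<alpha> * ?b (\<lambda>x. u (n + 1) x - ?q x) m"
      if m: "m \<in> {?q, u (n + 1), \<Lambda> n, \<Lambda> (n + 1)}" for m
    proof -
      have m: "m \<in> V\<^sub>g"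
        using m in_spaces(3,4) le solid_trace [OF q] fluid_trace by blast
      have restrict: "?b f (lifting \<Omega>\<^sub>f \<Sigma> \<T>\<^sub>f m) = ?b f m" for f
        by (rule L2_seg_cong [OF refl lifting(2) [OF m]])
      have "(\<lambda>x. 0) \<in> M\<^sub>f"
        unfolding spaces(3) M_space_def affine_on_elements_def
        by (auto intro!: exI [of _ "\<lambda>x. 0"] linear_zero)
      then show ?thesis
        using fluid [OF n lifting(1) [OF m], of "\<lambda>x. 0"] stress [OF n m] by (simp add: restrict)
    qed
    have interface_terms: "2 * (\<alpha> * ?b (\<lambda>x. ?q x - u n x) ?q + ?b (\<Lambda> n) ?q
        + \<alpha> * ?b (\<lambda>x. u (n + 1) x - ?q x) (u (n + 1)) - ?b (\<Lambda> n) (u (n + 1)))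
      = \<alpha> * ?b (\<lambda>x. ?q x - u n x) (\<lambda>x. ?q x - u n x)
        + \<alpha> * (?b (u (n + 1)) (u (n + 1)) - ?b (u n) (u n))
        + 1 / \<alpha> * (?b (\<Lambda> (n + 1)) (\<Lambda> (n + 1)) - ?b (\<Lambda> n) (\<Lambda> n))"
      using params(6) by (intro interface_work_identity cont update) auto
    have kinetic_s: "L2 \<Omega>\<^sub>s (ddt dt q (n + 1)) ?q
      = 1 / (2 * dt) * (L2 \<Omega>\<^sub>s (q (n + 1)) (q (n + 1)) - L2 \<Omega>\<^sub>s (q n) (q n))"
      unfolding L2_commute [of _ _ "mid q n"]
      by (rule L2_average_increment [where N = "{}"])
        (use n in \<open>auto intro!: set_integrable_inner_continuous [OF \<Omega>s] cont_s(1) in_spaces(1)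
          simp: mid_def ddt_def\<close>)
    have elastic: "a_solid L\<^sub>1 L\<^sub>2 \<Omega>\<^sub>s (mid \<eta> n) ?q
      = 1 / (2 * dt) * (a_solid L\<^sub>1 L\<^sub>2 \<Omega>\<^sub>s (\<eta> (n + 1)) (\<eta> (n + 1)) - a_solid L\<^sub>1 L\<^sub>2 \<Omega>\<^sub>s (\<eta> n) (\<eta> n))"
    proof (rule a_solid_average_increment [OF meshes(1) \<Omega>s])
      show "?q x = ddt dt \<eta> (n + 1) x" if "x \<in> \<Omega>\<^sub>s" for x
        using solid_kinematic [OF n] that closure_subset by blast
    qed (intro cont_s(2) in_spaces(2) le)+
    have kinetic_f: "L2 \<Omega>\<^sub>f (ddt dt u (n + 1)) (u (n + 1))
      = 1 / (2 * dt) * (L2 \<Omega>\<^sub>f (u (n + 1)) (u (n + 1)) - L2 \<Omega>\<^sub>f (u n) (u n)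
        + L2 \<Omega>\<^sub>f (\<lambda>x. u (n + 1) x - u n x) (\<lambda>x. u (n + 1) x - u n x))"
      using L2_increment_final [OF \<Omega>f cont_f(1) cont_f(1), OF in_spaces(3) in_spaces(3), OF le, of dt]
      by (simp add: ddt_def)
    have viscous: "a_fluid \<mu> h \<Omega>\<^sub>f (u (n + 1), p (n + 1)) (u (n + 1), p (n + 1))
      = 2 * \<mu> * L2 \<Omega>\<^sub>f (sym_grad (u (n + 1))) (sym_grad (u (n + 1)))
        + h\<^sup>2 * L2 \<Omega>\<^sub>f (grad (p (n + 1))) (grad (p (n + 1)))"
      using L2_commute [of \<Omega>\<^sub>f "p (n + 1)" "divg (u (n + 1))"] by (simp add: a_fluid_def)
    have slip: "?b (\<lambda>x. ddt dt \<eta> (n + 1) x - u n x) (\<lambda>x. ddt dt \<eta> (n + 1) x - u n x)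
        = ?b (\<lambda>x. ?q x - u n x) (\<lambda>x. ?q x - u n x)"
      using solid_kinematic [OF n] seg_closure(1) by (intro L2_seg_cong) auto
    \<comment> \<open>Adding the two tested equations and multiplying by \<open>2 * dt\<close> leaves all bulk terms as energy
      increments and dissipation.\<close>
    note solid_energy = solid_dynamic [OF n q, unfolded kinetic_s elastic]
    note fluid_energy = fluid [OF n fluid_spaces(1) [OF n] fluid_spaces(2) [OF n],
        unfolded kinetic_f viscous]
    have "2 * dt * (\<alpha> * ?b (\<lambda>x. ?q x - u n x) ?q + ?b (\<Lambda> n) ?q
        + \<alpha> * ?b (\<lambda>x. u (n + 1) x - ?q x) (u (n + 1)) - ?b (\<Lambda> n) (u (n + 1)))
      = - (\<rho>\<^sub>s * (L2 \<Omega>\<^sub>s (q (n + 1)) (q (n + 1)) - L2 \<Omega>\<^sub>s (q n) (q n))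
        + (a_solid L\<^sub>1 L\<^sub>2 \<Omega>\<^sub>s (\<eta> (n + 1)) (\<eta> (n + 1)) - a_solid L\<^sub>1 L\<^sub>2 \<Omega>\<^sub>s (\<eta> n) (\<eta> n))
        + \<rho>\<^sub>f * (L2 \<Omega>\<^sub>f (u (n + 1)) (u (n + 1)) - L2 \<Omega>\<^sub>f (u n) (u n)
          + L2 \<Omega>\<^sub>f (\<lambda>x. u (n + 1) x - u n x) (\<lambda>x. u (n + 1) x - u n x))
        + 4 * \<mu> * dt * L2 \<Omega>\<^sub>f (sym_grad (u (n + 1))) (sym_grad (u (n + 1)))
        + 2 * h\<^sup>2 * dt * L2 \<Omega>\<^sub>f (grad (p (n + 1))) (grad (p (n + 1))))"
    proof -
      \<comment> \<open>The variables \<open>A\<close>, \<open>B\<close>, \<open>C\<close> stand for the terms that carry the factor \<open>1 / (2 * dt)\<close>, \<open>D\<close>, \<open>E\<close> for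
        the dissipation by viscosity and stabilization, and the \<open>x\<close> for interface terms; abstracting them leaves a linear computation.\<close>
      have "x1 = - (\<rho>\<^sub>s * A + B + \<rho>\<^sub>f * C + 4 * \<mu> * dt * D + 2 * h\<^sup>2 * dt * E)"
        if "\<rho>\<^sub>s * (1 / (2 * dt) * A) + 1 / (2 * dt) * B + x2 + x3 = 0"
          "\<rho>\<^sub>f * (1 / (2 * dt) * C) + (2 * \<mu> * D + h\<^sup>2 * E) + x4 - x5 = 0"
          "x1 = 2 * dt * (x2 + x3 + x4 - x5)" for A B C D E x1 x2 x3 x4 x5 :: real
      proof -
        define A' B' C' where "A' = 1 / (2 * dt) * A" and "B' = 1 / (2 * dt) * B" and "C' = 1 / (2 * dt) * C"
        then have scale: "A = 2 * dt * A'" "B = 2 * dt * B'" "C = 2 * dt * C'"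
          using params(7) by simp_all
        have sol: "x2 = - (\<rho>\<^sub>s * A') - B' - x3" "x4 = x5 - \<rho>\<^sub>f * C' - 2 * \<mu> * D - h\<^sup>2 * E"
          using that(1,2) unfolding A'_def [symmetric] B'_def [symmetric] C'_def [symmetric] by linarith+
        show ?thesis
          unfolding that(3) scale sol by (simp add: algebra_simps)
      qed
      from this [OF solid_energy fluid_energy refl] show ?thesis .
    qed
    moreover have "2 * dt * (\<alpha> * ?b (\<lambda>x. ?q x - u n x) ?q + ?b (\<Lambda> n) ?q
        + \<alpha> * ?b (\<lambda>x. u (n + 1) x - ?q x) (u (n + 1)) - ?b (\<Lambda> n) (u (n + 1)))
      = dt * (\<alpha> * ?b (\<lambda>x. ?q x - u n x) (\<lambda>x. ?q x - u n x)
        + \<alpha> * (?b (u (n + 1)) (u (n + 1)) - ?b (u n) (u n))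
        + 1 / \<alpha> * (?b (\<Lambda> (n + 1)) (\<Lambda> (n + 1)) - ?b (\<Lambda> n) (\<Lambda> n)))"
      unfolding interface_terms [symmetric] by simp
    moreover have "Z (n + 1) = \<rho>\<^sub>f * L2 \<Omega>\<^sub>f (\<lambda>x. u (n + 1) x - u n x) (\<lambda>x. u (n + 1) x - u n x)
        + \<alpha> * dt * ?b (\<lambda>x. ?q x - u n x) (\<lambda>x. ?q x - u n x)
        + 4 * \<mu> * dt * L2 \<Omega>\<^sub>f (sym_grad (u (n + 1))) (sym_grad (u (n + 1)))
        + 2 * h\<^sup>2 * dt * L2 \<Omega>\<^sub>f (grad (p (n + 1))) (grad (p (n + 1)))"
      using Z [of "n + 1"] by (simp add: L2_norm_power2 L2_seg_norm_power2 slip [simplified])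
    ultimately show ?thesis
      unfolding S L2_norm_power2 L2_seg_norm_power2 by (simp only:) (simp add: algebra_simps)
  qed
  have "M \<le> N \<Longrightarrow> S M + (\<Sum>m = 1..M. Z m) = S 0"
  proof (induction M)
    case (Suc M)
    then show ?case
      using step [of M] by simp
  qed simp
  then show ?thesis
    using M(2) by blast
qed

end
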